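(* Let $\Phi$ be a crystallographic root system of rank $d$ with Weyl group $W$ and fundamental weights $\lambda_1,\dots,\lambda_d$. A weight polytope $P=\operatorname{conv}(Wx)$ ($x\in V$) is indecomposable if and only if $P=k\,\operatorname{conv}(W\lambda_i)$ for some $k>0$ and some $i\in[d]$ such that every edge of the Dynkin diagram incident to $i$ is unlabeled, i.e., $m_{ij}=3$ for all neighbors $j$ of $i$ (equivalently, the Dynkin diagram restricted to $N(i)\cup\{i\}$ is simply laced).
   Context: $V$ is a finite-dimensional real inner product space; $\Phi\subset V$ is a finite root system (spans $V$, only multiples of $\alpha\in\Phi$ in $\Phi$ are $\pm\alpha$, closed under $s_\alpha(x)=x-\frac{2\langle x,\alpha\rangle}{\langle\alpha,\alpha\rangle}\alpha$) which is crystallographic: $2\langle\alpha,\beta\rangle/\langle\alpha,\alpha\rangle\in\mathbb{Z}$ for all roots. $W$ is the group generated by the $s_\alpha$. Fix a chamber $D$ of the arrangement $\{\alpha^\perp\}$ with simple roots $\alpha_1,\dots,\alpha_d$; $s_i=s_{\alpha_i}$; coroots $\alpha^\vee=2\alpha/\langle\alpha,\alpha\rangle$; fundamental weights $\lambda_i$ with $\langle\lambda_i,\alpha_j^\vee\rangle=\delta_{ij}$. $m_{ij}$ is the order of $s_is_j$; the Dynkin diagram has vertices $[d]$ and an edge between $i\ne j$ whenever $m_{ij}>2$, labelled $m_{ij}$ (label $3$ is customarily omitted, i.e. "unlabeled"); $N(i)$ is the set of neighbors of $i$. A polytope $P$ is indecomposable if its only deformations (polytopes whose normal fan coarsens that of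 $P$) are, up to translation, nonnegative multiples of $P$, i.e., its deformation cone modulo translations is a single ray. *)

theory Defs
  imports
    "HOL-Analysis.Analysis"
    "HOL-Algebra.Bij"
    "HOL-Algebra.Generated_Groups"
    "HOL-Algebra.Multiplicative_Group"
begin

section \<open>Crystallographic root systems and Weyl groups\<close>

definition root_reflection :: "'a::euclidean_space \<Rightarrow> 'a \<Rightarrow> 'a" where
  "root_reflection \<alpha> x = x - (2 * (x \<bullet> \<alpha>) / (\<alpha> \<bullet> \<alpha>)) *\<^sub>R \<alpha>"

definition coroot :: "'a::euclidean_space \<Rightarrow> 'a" where
  "coroot \<alpha> = (2 / (\<alpha> \<bullet> \<alpha>)) *\<^sub>R \<alpha>"

definition root_system :: "'a::euclidean_space set \<Rightarrow> bool" where
  "root_system \<Phi> \<longleftrightarrow>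
     finite \<Phi> \<and> 0 \<notin> \<Phi> \<and> span \<Phi> = UNIV \<and>
     (\<forall>\<alpha>\<in>\<Phi>. \<forall>c. c *\<^sub>R \<alpha> \<in> \<Phi> \<longrightarrow> c = 1 \<or> c = -1) \<and>
     (\<forall>\<alpha>\<in>\<Phi>. root_reflection \<alpha> ` \<Phi> \<subseteq> \<Phi>)"

definition crystallographic :: "'a::euclidean_space set \<Rightarrow> bool" where
  "crystallographic \<Phi> \<longleftrightarrow> (\<forall>\<alpha>\<in>\<Phi>. \<forall>\<beta>\<in>\<Phi>. 2 * (\<alpha> \<bullet> \<beta>) / (\<alpha> \<bullet> \<alpha>) \<in> \<int>)"

definition weyl_group :: "'a::euclidean_space set \<Rightarrow> ('a \<Rightarrow> 'a) set" where
  "weyl_group \<Phi> = generate (BijGroup UNIV) (root_reflection ` \<Phi>)"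

section \<open>Chambers, simple roots, fundamental weights\<close>

text \<open>Chambers are taken to be closed.\<close>

definition chamber :: "'a::euclidean_space set \<Rightarrow> 'a set \<Rightarrow> bool" where
  "chamber \<Phi> D \<longleftrightarrow>
     (\<exists>K \<in> components (UNIV - (\<Union>\<alpha>\<in>\<Phi>. {x. x \<bullet> \<alpha> = 0})). D = closure K)"

text \<open>The simple roots of \<open>D\<close> are the inward-pointing roots orthogonal to the walls of \<open>D\<close>.\<close>

definition simple_roots :: "'a::euclidean_space set \<Rightarrow> 'a set \<Rightarrow> 'a set" where
  "simple_roots \<Phi> D =
     {\<alpha>\<in>\<Phi>. (\<forall>x\<in>D. 0 \<le> x \<bullet> \<alpha>) \<and> {x\<in>D. x \<bullet> \<alpha> = 0} facet_of D}"

definition simple_root_enumeration ::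
  "'a::euclidean_space set \<Rightarrow> 'a set \<Rightarrow> nat \<Rightarrow> (nat \<Rightarrow> 'a) \<Rightarrow> bool" where
  "simple_root_enumeration \<Phi> D d \<alpha> \<longleftrightarrow> bij_betw \<alpha> {1..d} (simple_roots \<Phi> D)"

definition fundamental_weights :: "nat \<Rightarrow> (nat \<Rightarrow> 'a::euclidean_space) \<Rightarrow> (nat \<Rightarrow> 'a) \<Rightarrow> bool" where
  "fundamental_weights d \<alpha> \<omega> \<longleftrightarrow>
     (\<forall>i\<in>{1..d}. \<forall>j\<in>{1..d}. \<omega> i \<bullet> coroot (\<alpha> j) = (if i = j then 1 else 0))"

section \<open>Dynkin diagram\<close>

text \<open>\<open>group.ord\<close> is \<open>0\<close> on elements of infinite order; these do not occur in a finite
  Weyl group.\<close>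

definition coxeter_order :: "(nat \<Rightarrow> 'a::euclidean_space) \<Rightarrow> nat \<Rightarrow> nat \<Rightarrow> nat" where
  "coxeter_order \<alpha> i j =
     group.ord (BijGroup UNIV)
       (root_reflection (\<alpha> i) \<otimes>\<^bsub>BijGroup UNIV\<^esub> root_reflection (\<alpha> j))"

definition dynkin_edge :: "nat \<Rightarrow> (nat \<Rightarrow> 'a::euclidean_space) \<Rightarrow> nat \<Rightarrow> nat \<Rightarrow> bool" where
  "dynkin_edge d \<alpha> i j \<longleftrightarrow>
     i \<in> {1..d} \<and> j \<in> {1..d} \<and> i \<noteq> j \<and> coxeter_order \<alpha> i j > 2"

definition dynkin_neighbors :: "nat \<Rightarrow> (nat \<Rightarrow> 'a::euclidean_space) \<Rightarrow> nat \<Rightarrow> nat set" where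
  "dynkin_neighbors d \<alpha> i = {j. dynkin_edge d \<alpha> i j}"

definition incident_edges_unlabeled :: "nat \<Rightarrow> (nat \<Rightarrow> 'a::euclidean_space) \<Rightarrow> nat \<Rightarrow> bool" where
  "incident_edges_unlabeled d \<alpha> i \<longleftrightarrow>
     (\<forall>j\<in>dynkin_neighbors d \<alpha> i. coxeter_order \<alpha> i j = 3)"

definition simply_laced_on :: "nat \<Rightarrow> (nat \<Rightarrow> 'a::euclidean_space) \<Rightarrow> nat set \<Rightarrow> bool" where
  "simply_laced_on d \<alpha> S \<longleftrightarrow>
     (\<forall>i\<in>S. \<forall>j\<in>S. dynkin_edge d \<alpha> i j \<longrightarrow> coxeter_order \<alpha> i j = 3)"

section \<open>Normal fans, deformations, indecomposability\<close>

text \<open>The dual space is identified with the ambient space via the inner product; normals are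
  outer normals.\<close>

definition normal_cone :: "'a::euclidean_space set \<Rightarrow> 'a set \<Rightarrow> 'a set" where
  "normal_cone P F = {u. \<forall>x\<in>F. \<forall>y\<in>P. u \<bullet> y \<le> u \<bullet> x}"

definition normal_fan :: "'a::euclidean_space set \<Rightarrow> 'a set set" where
  "normal_fan P = {normal_cone P F | F. F face_of P \<and> F \<noteq> {}}"

definition fan_coarsens :: "'a::euclidean_space set set \<Rightarrow> 'a set set \<Rightarrow> bool" where
  "fan_coarsens \<Sigma>' \<Sigma> \<longleftrightarrow> (\<forall>C\<in>\<Sigma>. \<exists>C'\<in>\<Sigma>'. C \<subseteq> C')"

definition deformation_of :: "'a::euclidean_space set \<Rightarrow> 'a set \<Rightarrow> bool" where
  "deformation_of P Q \<longleftrightarrow>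
     polytope Q \<and> Q \<noteq> {} \<and> fan_coarsens (normal_fan Q) (normal_fan P)"

text \<open>A single point is excluded: its deformation cone modulo translations is \<open>{0}\<close>, not a ray.
  The reverse inclusion, that translates of \<open>c P\<close> with \<open>c \<ge> 0\<close> are deformations of \<open>P\<close>, is
  automatic.\<close>

definition indecomposable :: "'a::euclidean_space set \<Rightarrow> bool" where
  "indecomposable P \<longleftrightarrow>
     polytope P \<and> P \<noteq> {} \<and> (\<nexists>p. P = {p}) \<and>
     (\<forall>Q. deformation_of P Q \<longrightarrow> (\<exists>c\<ge>0. \<exists>t. Q = (\<lambda>x. t + c *\<^sub>R x) ` P))"

definition weight_polytope :: "'a::euclidean_space set \<Rightarrow> 'a \<Rightarrow> 'a set" where
  "weight_polytope \<Phi> x = convex hull ((\<lambda>w. w x) ` weyl_group \<Phi>)"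

end

theory Submission
  imports Defs
begin

text \<open>The orbit polytope \<open>P x\<close> of a dominant vector \<open>x\<close> has support function \<open>u \<mapsto> u \<bullet> x\<close> on the
  dominant chamber. If \<open>y\<close> and \<open>x - y\<close> are dominant, \<open>P y\<close> is therefore a deformation of \<open>P x\<close>, and it
  is not a homothetic copy unless \<open>y\<close> is proportional to \<open>x\<close>. Hence only multiples of fundamental weights
  \<open>\<omega> i\<close> can give indecomposable polytopes. If \<open>i\<close> is incident to an edge labelled 4 or 6, then
  \<open>\<alpha> i\<close> and its neighbour have different lengths, and the roots of the length of \<open>\<alpha> i\<close> form a
  subsystem with the same orbit of \<open>\<omega> i\<close> in which \<open>\<omega> i\<close> is a sum of two dominant vectors that are not
  proportional to it. If all edges at \<open>i\<close> are unlabelled, every two-dimensional face is a triangle, so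
  a deformation scales all edges by one common factor.\<close>

section \<open>Words of reflections and their orbits\<close>

text \<open>The step that needs an idea is the splitting of \<open>\<omega> i\<close> along a
  labelled edge. The subsystem used there comes without a chamber and may fail to span, so simple
  systems are built from a regular vector alone, and one Weyl vector serves both systems. No orbit
  point is lost: a simple reflection other than the i-th fixes \<open>\<omega> i\<close> and
  permutes the roots of a given length, so it can be pushed through a word of subsystem reflections,
  conjugating the letters, until \<open>\<omega> i\<close> absorbs it. In the subsystem both
  \<open>\<alpha> i\<close> and its mirror image under the neighbouring reflection are simple and
  pair equally and positively with \<open>\<omega> i\<close>, so one of the two coordinates can be
  removed. Integrality enters through the Cartan products: they lie in {0, 1, 2, 3}, and for
  adjacent simple roots of equal length the product is a nonzero square, hence 1. A label other than
  3 therefore forces a change of length.\<close>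

lemma linear_root_reflection: "linear (root_reflection a)"
  by (rule linearI) (simp_all add: root_reflection_def algebra_simps inner_add_left add_divide_distrib)

lemma root_reflection_scaleR: "root_reflection a (r *\<^sub>R x) = r *\<^sub>R root_reflection a x"
  using linear_root_reflection linear_scale by blast

lemma root_reflection_diff: "root_reflection a (x - y) = root_reflection a x - root_reflection a y"
  using linear_root_reflection linear_diff by blast

lemma inner_root_reflection: "root_reflection a x \<bullet> root_reflection a y = x \<bullet> y"
proof (cases "a = 0")
  case False
  have "root_reflection a x \<bullet> root_reflection a y
    = x \<bullet> y - 2 * (2 * (x \<bullet> a) / (a \<bullet> a)) * (y \<bullet> a) + (2 * (x \<bullet> a) / (a \<bullet> a)) * (2 * (y \<bullet> a))"
    using False by (simp add: root_reflection_def inner_diff_left inner_diff_right inner_commute)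
  then show ?thesis by simp
qed (simp add: root_reflection_def)

lemma root_reflection_invol [simp]: "root_reflection a (root_reflection a x) = x"
  by (cases "a = 0") (simp_all add: root_reflection_def inner_diff_left algebra_simps)

lemma inner_root_reflection_commute: "root_reflection a x \<bullet> y = x \<bullet> root_reflection a y"
  by (metis inner_root_reflection root_reflection_invol)

lemma root_reflection_self: "a \<noteq> 0 \<Longrightarrow> root_reflection a a = - a"
  by (simp add: root_reflection_def scaleR_2)

lemma root_reflection_uminus: "root_reflection (- a) = root_reflection a"
  by (auto simp: root_reflection_def)

lemma root_reflection_eq_self: "x \<bullet> a = 0 \<Longrightarrow> root_reflection a x = x"
  by (simp add: root_reflection_def)

text \<open>An isometry conjugates the reflection in \<open>a\<close> into the reflection in the
  image of \<open>a\<close>.\<close>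

lemma root_reflection_conj:
  "root_reflection b (root_reflection a x) = root_reflection (root_reflection b a) (root_reflection b x)"
  unfolding root_reflection_def[of a] root_reflection_def[of "root_reflection b a"]
  by (simp add: inner_root_reflection root_reflection_diff root_reflection_scaleR)

text \<open>Group elements are handled as lists because the exchange argument shortens words;
  \<open>weyl_group_words\<close> links them to the group.\<close>

definition reflect_word :: "'a::euclidean_space list \<Rightarrow> 'a \<Rightarrow> 'a" where
  "reflect_word ws x = foldr root_reflection ws x"

lemma reflect_word_Nil [simp]: "reflect_word [] x = x"
  and reflect_word_Cons [simp]: "reflect_word (a # ws) x = root_reflection a (reflect_word ws x)"
  and reflect_word_append [simp]: "reflect_word (vs @ ws) x = reflect_word vs (reflect_word ws x)"
  by (simp_all add: reflect_word_def)

lemma linear_reflect_word: "linear (reflect_word ws)"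
proof (induction ws)
  case Nil
  show ?case by (simp add: reflect_word_def linear_iff)
next
  case (Cons a ws)
  have "reflect_word (a # ws) = root_reflection a \<circ> reflect_word ws" by auto
  then show ?case by (metis linear_compose[OF Cons linear_root_reflection])
qed

lemma reflect_word_diff: "reflect_word ws (x - y) = reflect_word ws x - reflect_word ws y"
  and reflect_word_add: "reflect_word ws (x + y) = reflect_word ws x + reflect_word ws y"
  and reflect_word_scaleR: "reflect_word ws (r *\<^sub>R x) = r *\<^sub>R reflect_word ws x"
  using linear_reflect_word linear_diff linear_add linear_scale by blast+

lemma inner_reflect_word: "reflect_word ws x \<bullet> reflect_word ws y = x \<bullet> y"
  by (induction ws) (simp_all add: inner_root_reflection)

lemma reflect_word_rev [simp]: "reflect_word (rev ws) (reflect_word ws x) = x"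
  and reflect_word_rev' [simp]: "reflect_word ws (reflect_word (rev ws) x) = x"
  by (induction ws arbitrary: x) simp_all

lemma inner_reflect_word_commute: "reflect_word ws x \<bullet> y = x \<bullet> reflect_word (rev ws) y"
  by (metis inner_reflect_word reflect_word_rev')

lemma norm_reflect_word: "norm (reflect_word ws x) = norm x"
  by (simp add: norm_eq_sqrt_inner inner_reflect_word)

lemma reflect_word_conj:
  "reflect_word ws (root_reflection a x) = root_reflection (reflect_word ws a) (reflect_word ws x)"
proof (induction ws)
  case (Cons b ws)
  then show ?case using root_reflection_conj[of b "reflect_word ws a" "reflect_word ws x"] by simp
qed simp

text \<open>Moving a reflection to the right end of a word conjugates every letter; if it fixes
  \<open>x\<close>, it then disappears.\<close>

lemma root_reflection_reflect_word:
  "root_reflection b (reflect_word ws x) = reflect_word (map (root_reflection b) ws) (root_reflection b x)"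
proof (induction ws)
  case (Cons a ws)
  then show ?case using root_reflection_conj[of b a "reflect_word ws x"] by simp
qed simp

definition orbit :: "'a::euclidean_space set \<Rightarrow> 'a \<Rightarrow> 'a set" where
  "orbit \<Psi> x = {reflect_word ws x | ws. set ws \<subseteq> \<Psi>}"

lemma orbitI: "set ws \<subseteq> \<Psi> \<Longrightarrow> reflect_word ws x \<in> orbit \<Psi> x"
  unfolding orbit_def by blast

lemma orbit_refl: "x \<in> orbit \<Psi> x"
proof -
  have "set [] \<subseteq> \<Psi>" "x = reflect_word [] x" by auto
  then show ?thesis unfolding orbit_def by blast
qed

lemma orbit_reflect_word: "set ws \<subseteq> \<Psi> \<Longrightarrow> y \<in> orbit \<Psi> x \<Longrightarrow> reflect_word ws y \<in> orbit \<Psi> x"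
proof -
  assume ws: "set ws \<subseteq> \<Psi>" and "y \<in> orbit \<Psi> x"
  then obtain vs where "set vs \<subseteq> \<Psi>" "y = reflect_word vs x" by (auto simp: orbit_def)
  with ws have "set (ws @ vs) \<subseteq> \<Psi>" "reflect_word ws y = reflect_word (ws @ vs) x" by auto
  then show ?thesis unfolding orbit_def by blast
qed

lemma orbit_root_reflection: "a \<in> \<Psi> \<Longrightarrow> y \<in> orbit \<Psi> x \<Longrightarrow> root_reflection a y \<in> orbit \<Psi> x"
  using orbit_reflect_word[of "[a]"] by simp

lemma orbit_mono: "\<Psi>' \<subseteq> \<Psi> \<Longrightarrow> orbit \<Psi>' x \<subseteq> orbit \<Psi> x"
  unfolding orbit_def by blast

lemma orbit_induct [consumes 1, case_names refl step]:
  assumes "y \<in> orbit \<Psi> x" and "P x"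
    and "\<And>y a. y \<in> orbit \<Psi> x \<Longrightarrow> P y \<Longrightarrow> a \<in> \<Psi> \<Longrightarrow> P (root_reflection a y)"
  shows "P y"
proof -
  obtain ws where "set ws \<subseteq> \<Psi>" "y = reflect_word ws x"
    using assms(1) by (auto simp: orbit_def)
  moreover have "set ws \<subseteq> \<Psi> \<Longrightarrow> P (reflect_word ws x)" for ws
    by (induction ws) (auto simp: assms(2) orbit_def intro!: assms(3))
  ultimately show ?thesis by blast
qed

lemma orbit_scaleR: "orbit \<Psi> (r *\<^sub>R x) = (\<lambda>v. r *\<^sub>R v) ` orbit \<Psi> x"
  by (auto simp: orbit_def reflect_word_scaleR)

lemma orbit_sym: "y \<in> orbit \<Psi> x \<Longrightarrow> x \<in> orbit \<Psi> y"
proof -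
  assume "y \<in> orbit \<Psi> x"
  then obtain ws where "set ws \<subseteq> \<Psi>" "y = reflect_word ws x" by (auto simp: orbit_def)
  then have "set (rev ws) \<subseteq> \<Psi>" "x = reflect_word (rev ws) y" by auto
  then show ?thesis unfolding orbit_def by blast
qed

lemma orbit_trans: "y \<in> orbit \<Psi> x \<Longrightarrow> z \<in> orbit \<Psi> y \<Longrightarrow> z \<in> orbit \<Psi> x"
  using orbit_reflect_word unfolding orbit_def[of \<Psi> y] by blast

lemma orbit_eq: "y \<in> orbit \<Psi> x \<Longrightarrow> orbit \<Psi> y = orbit \<Psi> x"
  using orbit_sym orbit_trans by blast

section \<open>Finitely generated cones\<close>

text \<open>For finite \<open>S\<close> the convex cone generated by \<open>S\<close>; for infinite
  \<open>S\<close> it collapses to 0, as such sums are 0 by convention.\<close>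

definition nonneg_span :: "'a::real_vector set \<Rightarrow> 'a set" where
  "nonneg_span S = {\<Sum>v\<in>S. b v *\<^sub>R v | b. \<forall>v\<in>S. 0 \<le> b v}"

lemma nonneg_spanI: "(\<And>v. v \<in> S \<Longrightarrow> 0 \<le> b v) \<Longrightarrow> (\<Sum>v\<in>S. b v *\<^sub>R v) \<in> nonneg_span S"
  unfolding nonneg_span_def by blast

lemma nonneg_span_0: "0 \<in> nonneg_span S"
  using nonneg_spanI[of S "\<lambda>_. 0"] by simp

lemma nonneg_span_add: "u \<in> nonneg_span S \<Longrightarrow> v \<in> nonneg_span S \<Longrightarrow> u + v \<in> nonneg_span S"
proof -
  assume "u \<in> nonneg_span S" "v \<in> nonneg_span S"
  then obtain b b' where "\<forall>w\<in>S. 0 \<le> b w" "u = (\<Sum>w\<in>S. b w *\<^sub>R w)"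
    "\<forall>w\<in>S. 0 \<le> b' w" "v = (\<Sum>w\<in>S. b' w *\<^sub>R w)"
    unfolding nonneg_span_def by blast
  then show ?thesis
    using nonneg_spanI[of S "\<lambda>w. b w + b' w"] by (simp add: scaleR_add_left sum.distrib)
qed

lemma nonneg_span_scaleR: "u \<in> nonneg_span S \<Longrightarrow> 0 \<le> r \<Longrightarrow> r *\<^sub>R u \<in> nonneg_span S"
proof -
  assume "u \<in> nonneg_span S" "0 \<le> r"
  then obtain b where "\<forall>w\<in>S. 0 \<le> b w" "u = (\<Sum>w\<in>S. b w *\<^sub>R w)"
    unfolding nonneg_span_def by blast
  then show ?thesis
    using nonneg_spanI[of S "\<lambda>w. r * b w"] \<open>0 \<le> r\<close> by (simp add: scaleR_sum_right)
qed

lemma nonneg_span_base: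
  assumes "finite S" "v \<in> S" shows "v \<in> nonneg_span S"
proof -
  have "(\<Sum>w\<in>S. (if w = v then 1 else 0 :: real) *\<^sub>R w) = v"
    using assms by (simp add: if_distrib[of "\<lambda>r. r *\<^sub>R _"] sum.delta cong: if_cong)
  then show ?thesis using nonneg_spanI[of S "\<lambda>w. if w = v then 1 else 0"] by fastforce
qed

lemma nonneg_span_sum:
  "(\<And>i. i \<in> I \<Longrightarrow> f i \<in> nonneg_span S) \<Longrightarrow> sum f I \<in> nonneg_span S"
  by (induction I rule: infinite_finite_induct) (auto simp: nonneg_span_0 nonneg_span_add)

lemma nonneg_span_subset:
  "T \<subseteq> nonneg_span S \<Longrightarrow> nonneg_span T \<subseteq> nonneg_span S"
  unfolding nonneg_span_def[of T] by (auto intro!: nonneg_span_sum nonneg_span_scaleR)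

lemma nonneg_span_remove:
  assumes "finite S" "a \<in> S" "v \<in> nonneg_span S"
  obtains r u where "0 \<le> r" "u \<in> nonneg_span (S - {a})" "v = r *\<^sub>R a + u"
proof -
  obtain b where b: "\<forall>w\<in>S. 0 \<le> b w" "v = (\<Sum>w\<in>S. b w *\<^sub>R w)"
    using assms(3) unfolding nonneg_span_def by blast
  show ?thesis
  proof (rule that)
    show "0 \<le> b a" using b assms by blast
    show "(\<Sum>w\<in>S - {a}. b w *\<^sub>R w) \<in> nonneg_span (S - {a})" using b by (auto intro: nonneg_spanI)
    show "v = b a *\<^sub>R a + (\<Sum>w\<in>S - {a}. b w *\<^sub>R w)"
      using b assms by (simp add: sum.remove)
  qed
qed

lemma nonneg_span_inner_nonneg:
  assumes "v \<in> nonneg_span S" "\<And>w. w \<in> S \<Longrightarrow> 0 \<le> u \<bullet> w" shows "0 \<le> u \<bullet> v"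
  using assms unfolding nonneg_span_def by (auto simp: inner_sum_right intro!: sum_nonneg)

lemma nonneg_span_inner_eq_0:
  assumes "finite S" "v \<in> nonneg_span S" "\<And>w. w \<in> S \<Longrightarrow> 0 < u \<bullet> w" "u \<bullet> v = 0" shows "v = 0"
proof -
  obtain b where b: "\<forall>w\<in>S. 0 \<le> b w" "v = (\<Sum>w\<in>S. b w *\<^sub>R w)"
    using assms(2) unfolding nonneg_span_def by blast
  have "(\<Sum>w\<in>S. b w * (u \<bullet> w)) = 0" using b assms(4) by (simp add: inner_sum_right)
  moreover have "\<And>w. w \<in> S \<Longrightarrow> 0 \<le> b w * (u \<bullet> w)" using b assms(3) by (simp add: less_imp_le)
  ultimately have "\<forall>w\<in>S. b w * (u \<bullet> w) = 0"
    using sum_nonneg_eq_0_iff[OF assms(1), of "\<lambda>w. b w * (u \<bullet> w)"] by simp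
  then have "\<forall>w\<in>S. b w = 0" using assms(3) by force
  then show ?thesis using b by simp
qed

lemma nonneg_span_linear_image:
  assumes "linear f" "finite S" "v \<in> nonneg_span S" shows "f v \<in> nonneg_span (f ` S)"
proof -
  obtain b where b: "\<forall>w\<in>S. 0 \<le> b w" "v = (\<Sum>w\<in>S. b w *\<^sub>R w)"
    using assms(3) unfolding nonneg_span_def by blast
  have "f v = (\<Sum>w\<in>S. b w *\<^sub>R f w)"
    by (simp add: b(2) linear_sum[OF assms(1)] linear_scale[OF assms(1)])
  also have "\<dots> \<in> nonneg_span (f ` S)"
    using b(1) assms(2) by (intro nonneg_span_sum nonneg_span_scaleR nonneg_span_base) auto
  finally show ?thesis .
qed

section \<open>Simple systems\<close>

text \<open>\<open>\<Delta>\<close> is the simple system of \<open>\<Psi>\<close> with respect to the regular vector \<open>c\<close>. Linear independence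
  of \<open>\<Delta>\<close> is replaced by cone-minimality, and \<open>\<Psi>\<close> need not span the space, so that subsystems are
  covered as well.\<close>

locale root_base =
  fixes \<Psi> \<Delta> :: "'a::euclidean_space set" and c :: 'a
  assumes finite_roots: "finite \<Psi>"
    and reduced: "\<And>\<beta> r. \<beta> \<in> \<Psi> \<Longrightarrow> r *\<^sub>R \<beta> \<in> \<Psi> \<Longrightarrow> r = 1 \<or> r = -1"
    and reflect_root: "\<And>\<beta> \<gamma>. \<beta> \<in> \<Psi> \<Longrightarrow> \<gamma> \<in> \<Psi> \<Longrightarrow> root_reflection \<beta> \<gamma> \<in> \<Psi>"
    and regular: "\<And>\<beta>. \<beta> \<in> \<Psi> \<Longrightarrow> c \<bullet> \<beta> \<noteq> 0"
    and finite_orbit: "\<And>x. finite (orbit \<Psi> x)"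
    and simple_root: "\<And>\<delta>. \<delta> \<in> \<Delta> \<Longrightarrow> \<delta> \<in> \<Psi>"
    and simple_pos: "\<And>\<delta>. \<delta> \<in> \<Delta> \<Longrightarrow> 0 < c \<bullet> \<delta>"
    and pos_root_nonneg_span: "\<And>\<beta>. \<beta> \<in> \<Psi> \<Longrightarrow> 0 < c \<bullet> \<beta> \<Longrightarrow> \<beta> \<in> nonneg_span \<Delta>"
    and simple_minimal: "\<And>\<delta>. \<delta> \<in> \<Delta> \<Longrightarrow> \<delta> \<notin> nonneg_span (\<Delta> - {\<delta>})"
begin

lemma root_nonzero: "\<beta> \<in> \<Psi> \<Longrightarrow> \<beta> \<noteq> 0"
  using regular by force

lemma finite_simple: "finite \<Delta>"
  by (rule finite_subset[OF _ finite_roots]) (auto intro: simple_root)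

lemma uminus_root: "\<beta> \<in> \<Psi> \<Longrightarrow> - \<beta> \<in> \<Psi>"
  by (metis reflect_root root_nonzero root_reflection_self)

lemma nonneg_span_simple_eq_0: "v \<in> nonneg_span \<Delta> \<Longrightarrow> c \<bullet> v = 0 \<Longrightarrow> v = 0"
  by (rule nonneg_span_inner_eq_0[OF finite_simple _ simple_pos])

lemma nonneg_span_simple_nonneg: "v \<in> nonneg_span \<Delta> \<Longrightarrow> 0 \<le> c \<bullet> v"
  by (erule nonneg_span_inner_nonneg) (simp add: simple_pos less_imp_le)

lemma pos_root_scaleR_eq:
  assumes "\<beta> \<in> \<Psi>" "r *\<^sub>R \<beta> \<in> \<Psi>" "0 < c \<bullet> \<beta>" "0 < c \<bullet> (r *\<^sub>R \<beta>)" shows "r = 1"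
  using reduced[OF assms(1,2)] assms(3,4) by auto

text \<open>A simple root spans an extreme ray of the cone of \<open>\<Delta>\<close>. This is what
  cone-minimality yields, and the sign and angle properties of simple roots follow from it.\<close>

lemma simple_extreme:
  assumes "\<delta> \<in> \<Delta>" "v \<in> nonneg_span \<Delta>" "r *\<^sub>R \<delta> - v \<in> nonneg_span \<Delta>"
  obtains b where "v = b *\<^sub>R \<delta>"
proof -
  let ?C = "nonneg_span (\<Delta> - {\<delta>})"
  have sub: "?C \<subseteq> nonneg_span \<Delta>"
    by (intro nonneg_span_subset) (auto intro: nonneg_span_base finite_simple)
  obtain b v1 where b: "0 \<le> b" "v1 \<in> ?C" "v = b *\<^sub>R \<delta> + v1"
    using nonneg_span_remove[OF finite_simple assms(1,2)] .
  obtain b' v2 where b': "0 \<le> b'" "v2 \<in> ?C" "r *\<^sub>R \<delta> - v = b' *\<^sub>R \<delta> + v2"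
    using nonneg_span_remove[OF finite_simple assms(1,3)] .
  have eq: "(r - b - b') *\<^sub>R \<delta> = v1 + v2"
    using b b' by (simp add: algebra_simps)
  have v12: "v1 + v2 \<in> ?C" using b b' by (auto intro: nonneg_span_add)
  \<comment> \<open>Dividing by a positive coefficient would put \<open>\<delta>\<close> into the
    cone of the other simple roots.\<close>
  have "r - b - b' \<le> 0"
  proof (rule ccontr)
    assume *: "\<not> r - b - b' \<le> 0"
    then have "\<delta> = (1 / (r - b - b')) *\<^sub>R (v1 + v2)" by (simp flip: eq)
    also have "\<dots> \<in> ?C" using v12 * by (intro nonneg_span_scaleR) auto
    finally show False using simple_minimal assms(1) by blast
  qed
  then have "c \<bullet> (v1 + v2) \<le> 0"
    unfolding eq[symmetric] using simple_pos[OF assms(1)] by (simp add: mult_nonpos_nonneg)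
  moreover have "0 \<le> c \<bullet> v1" "0 \<le> c \<bullet> v2"
    using b b' sub nonneg_span_simple_nonneg by auto
  ultimately have "c \<bullet> v1 = 0" by (simp add: inner_add_right)
  then have "v1 = 0" using b sub by (auto intro: nonneg_span_simple_eq_0)
  with b that[of b] show ?thesis by simp
qed

text \<open>If the image were negative, \<open>\<beta>\<close> and some multiple of
  \<open>\<delta>\<close> minus \<open>\<beta>\<close> would both lie in the cone, so
  \<open>\<beta>\<close> would lie on the extreme ray of \<open>\<delta>\<close>.\<close>

lemma simple_reflection_pos:
  assumes "\<delta> \<in> \<Delta>" "\<beta> \<in> \<Psi>" "0 < c \<bullet> \<beta>" "\<beta> \<noteq> \<delta>"
  shows "0 < c \<bullet> root_reflection \<delta> \<beta>"
proof (rule ccontr)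
  assume "\<not> ?thesis"
  moreover have root: "root_reflection \<delta> \<beta> \<in> \<Psi>" using assms by (auto intro: reflect_root simple_root)
  ultimately have "0 < c \<bullet> (- root_reflection \<delta> \<beta>)" using regular by (force simp: less_le)
  then have "- root_reflection \<delta> \<beta> \<in> nonneg_span \<Delta>"
    by (intro pos_root_nonneg_span uminus_root root)
  then have "(2 * (\<beta> \<bullet> \<delta>) / (\<delta> \<bullet> \<delta>)) *\<^sub>R \<delta> - \<beta> \<in> nonneg_span \<Delta>"
    by (simp add: root_reflection_def)
  then obtain b where "\<beta> = b *\<^sub>R \<delta>"
    by (rule simple_extreme[OF assms(1) pos_root_nonneg_span[OF assms(2,3)]])
  then show False using assms simple_root simple_pos pos_root_scaleR_eq[of \<delta> b] by simp
qed

text \<open>Otherwise the positive root \<open>root_reflection \<delta> \<gamma>\<close> plus a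
  positive multiple of \<open>\<delta>\<close> would decompose the extreme vector
  \<open>\<gamma>\<close> inside the cone.\<close>

lemma simple_obtuse:
  assumes "\<delta> \<in> \<Delta>" "\<gamma> \<in> \<Delta>" "\<gamma> \<noteq> \<delta>" shows "\<gamma> \<bullet> \<delta> \<le> 0"
proof (rule ccontr)
  assume *: "\<not> ?thesis"
  define r where "r = 2 * (\<gamma> \<bullet> \<delta>) / (\<delta> \<bullet> \<delta>)"
  have "\<delta> \<noteq> 0" by (intro root_nonzero simple_root assms)
  then have r: "0 < r" using * by (simp add: r_def)
  have "root_reflection \<delta> \<gamma> \<in> nonneg_span \<Delta>"
    by (intro pos_root_nonneg_span reflect_root simple_reflection_pos) (simp_all add: assms simple_root simple_pos)
  then have "1 *\<^sub>R \<gamma> - r *\<^sub>R \<delta> \<in> nonneg_span \<Delta>" by (simp add: root_reflection_def r_def)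
  moreover have "r *\<^sub>R \<delta> \<in> nonneg_span \<Delta>"
    using r by (intro nonneg_span_scaleR nonneg_span_base finite_simple assms) auto
  ultimately obtain b where b: "r *\<^sub>R \<delta> = b *\<^sub>R \<gamma>" using simple_extreme[OF assms(2)] by blast
  have "(b / r) *\<^sub>R \<gamma> = (1 / r) *\<^sub>R (b *\<^sub>R \<gamma>)" by simp
  also have "\<dots> = \<delta>" using r by (simp flip: b)
  finally have "\<delta> = (b / r) *\<^sub>R \<gamma>" ..
  moreover from this have "b / r = 1"
    using pos_root_scaleR_eq[of \<gamma> "b / r"] assms(1,2) by (metis simple_root simple_pos)
  ultimately show False using assms(3) by simp
qed

text \<open>An extreme ray is not generated by other rays of the cone. This is the test by which
  simple roots of a subsystem are recognised.\<close>

lemma simple_in_generating_set: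
  assumes "\<delta> \<in> \<Delta>" "S \<subseteq> \<Psi>" "\<And>\<gamma>. \<gamma> \<in> S \<Longrightarrow> 0 < c \<bullet> \<gamma>" "\<delta> \<in> nonneg_span S"
  shows "\<delta> \<in> S"
proof -
  have finS: "finite S" using assms(2) finite_roots by (rule finite_subset)
  obtain b where b: "\<forall>w\<in>S. 0 \<le> b w" "\<delta> = (\<Sum>w\<in>S. b w *\<^sub>R w)"
    using assms(4) unfolding nonneg_span_def by blast
  have "\<delta> \<noteq> 0" by (intro root_nonzero simple_root assms)
  then obtain \<gamma> where \<gamma>: "\<gamma> \<in> S" "b \<gamma> \<noteq> 0"
    using b(2) sum.neutral[of S "\<lambda>w. b w *\<^sub>R w"] by fastforce
  have mem: "b w *\<^sub>R w \<in> nonneg_span \<Delta>" if "w \<in> S" for w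
    using b that assms(2,3) by (intro nonneg_span_scaleR pos_root_nonneg_span) auto
  have "1 *\<^sub>R \<delta> - b \<gamma> *\<^sub>R \<gamma> = (\<Sum>w\<in>S - {\<gamma>}. b w *\<^sub>R w)"
    using b(2) finS \<gamma> by (simp add: sum.remove)
  also have "\<dots> \<in> nonneg_span \<Delta>" using mem by (intro nonneg_span_sum) auto
  finally obtain r where r: "b \<gamma> *\<^sub>R \<gamma> = r *\<^sub>R \<delta>"
    by (rule simple_extreme[OF assms(1) mem[OF \<gamma>(1)]])
  have "(r / b \<gamma>) *\<^sub>R \<delta> = (1 / b \<gamma>) *\<^sub>R (r *\<^sub>R \<delta>)" by simp
  also have "\<dots> = \<gamma>" using \<gamma>(2) by (simp flip: r)
  finally have eq: "\<gamma> = (r / b \<gamma>) *\<^sub>R \<delta>" ..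
  then have "r / b \<gamma> = 1"
    using pos_root_scaleR_eq[of \<delta> "r / b \<gamma>"] assms(2) assms(3)[OF \<gamma>(1)] \<gamma>(1)
      simple_root[OF assms(1)] simple_pos[OF assms(1)] by auto
  then have "\<gamma> = \<delta>" using eq by simp
  with \<gamma> show ?thesis by blast
qed

text \<open>Pairwise obtuse vectors in an open halfspace are independent: separating a relation by
  the signs of its coefficients writes one vector \<open>v\<close> in two ways, and multiplying the
  two gives \<open>v \<bullet> v \<le> 0\<close>.\<close>

lemma independent_simple: "independent \<Delta>"
proof (rule independent_if_scalars_zero[OF finite_simple])
  fix f \<gamma> assume sum0: "(\<Sum>x\<in>\<Delta>. f x *\<^sub>R x) = 0" and \<gamma>: "\<gamma> \<in> \<Delta>"
  define A where "A = {x\<in>\<Delta>. 0 < f x}"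
  define v where "v = (\<Sum>x\<in>A. f x *\<^sub>R x)"
  have A: "A \<subseteq> \<Delta>" "finite A" using finite_simple by (auto simp: A_def)
  have "(\<Sum>x\<in>\<Delta> - A. f x *\<^sub>R x) + v = 0"
    unfolding v_def using sum.subset_diff[OF A(1) finite_simple, of "\<lambda>x. f x *\<^sub>R x"] sum0 by simp
  then have v': "v = (\<Sum>x\<in>\<Delta> - A. (- f x) *\<^sub>R x)"
    by (simp add: sum_negf eq_neg_iff_add_eq_0 add.commute)
  have "v \<bullet> v = (\<Sum>x\<in>A. \<Sum>y\<in>\<Delta> - A. f x * (- f y) * (x \<bullet> y))"
  proof -
    have "v \<bullet> v = (\<Sum>x\<in>A. f x *\<^sub>R x) \<bullet> (\<Sum>x\<in>\<Delta> - A. (- f x) *\<^sub>R x)"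
      using v' v_def by simp
    also have "\<dots> = (\<Sum>x\<in>A. \<Sum>y\<in>\<Delta> - A. f x *\<^sub>R x \<bullet> (- f y) *\<^sub>R y)"
      by (simp only: inner_sum_left) (simp only: inner_sum_right)
    finally show ?thesis by (simp add: mult_ac)
  qed
  also have "\<dots> \<le> 0"
  proof (intro sum_nonpos)
    fix x y assume "x \<in> A" "y \<in> \<Delta> - A"
    then have "0 \<le> f x * (- f y)" "x \<bullet> y \<le> 0"
      using simple_obtuse[of y x] by (auto simp: A_def mult_nonneg_nonpos)
    then show "f x * - f y * (x \<bullet> y) \<le> 0" by (rule mult_nonneg_nonpos)
  qed
  finally have "v = 0" by (metis inner_ge_zero inner_eq_zero_iff order_antisym)
  \<comment> \<open>Each sign part now vanishes on its own; pairing with \<open>c\<close> turns it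
    into a vanishing sum of nonnegative numbers.\<close>
  have f0: "f x = 0" if "(\<Sum>x\<in>B. g x *\<^sub>R x) = 0" "B \<subseteq> \<Delta>" "\<And>x. x \<in> B \<Longrightarrow> 0 \<le> g x" "x \<in> B" "g x = 0 \<longleftrightarrow> f x = 0"
    for B g x
  proof -
    have "(\<Sum>x\<in>B. g x * (c \<bullet> x)) = 0"
      using arg_cong[OF that(1), of "inner c"] by (simp add: inner_sum_right)
    moreover have "\<And>x. x \<in> B \<Longrightarrow> 0 \<le> g x * (c \<bullet> x)"
      using that simple_pos by (meson in_mono less_imp_le mult_nonneg_nonneg)
    ultimately have "\<forall>x\<in>B. g x * (c \<bullet> x) = 0"
      using sum_nonneg_eq_0_iff[OF finite_subset[OF that(2) finite_simple], of "\<lambda>x. g x * (c \<bullet> x)"] by simp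
    then show ?thesis using that simple_pos[of x] by fastforce
  qed
  show "f \<gamma> = 0"
  proof (cases "\<gamma> \<in> A")
    case True
    then show ?thesis using f0[where B = A and g = f and x = \<gamma>] \<open>v = 0\<close> v_def A by (auto simp: A_def)
  next
    case False
    then show ?thesis using \<open>v = 0\<close> v' \<gamma>
      by (intro f0[where B = "\<Delta> - A" and g = "\<lambda>x. - f x" and x = \<gamma>]) (auto simp: A_def)
  qed
qed

lemma simple_dual_vector: obtains y where "\<And>\<delta>. \<delta> \<in> \<Delta> \<Longrightarrow> y \<bullet> \<delta> = g \<delta>"
proof -
  obtain f :: "'a \<Rightarrow> real" where f: "linear f" "\<forall>\<delta>\<in>\<Delta>. f \<delta> = g \<delta>"
    using linear_independent_extend[OF independent_simple, of g] by blast
  have "adjoint f 1 \<bullet> \<delta> = g \<delta>" if "\<delta> \<in> \<Delta>" for \<delta>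
    using adjoint_works[OF f(1), of \<delta> 1] f(2) that by (simp add: inner_commute)
  with that show ?thesis by blast
qed

text \<open>Minimal counterexample in the height \<open>c \<bullet> \<beta>\<close>: some simple
  reflection lowers a positive root that is not simple, and conjugating back gives the word.\<close>

lemma reflection_simple_word:
  assumes "\<beta> \<in> \<Psi>"
  obtains ws where "set ws \<subseteq> \<Delta>" "\<And>x. root_reflection \<beta> x = reflect_word ws x"
proof -
  define good where "good \<beta> \<longleftrightarrow> (\<exists>ws. set ws \<subseteq> \<Delta> \<and> (\<forall>x. root_reflection \<beta> x = reflect_word ws x))" for \<beta>
  define B where "B = {\<beta>\<in>\<Psi>. 0 < c \<bullet> \<beta> \<and> \<not> good \<beta>}"
  have "B = {}"
  proof (rule ccontr)
    assume "B \<noteq> {}"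
    moreover have "finite B" using finite_roots by (simp add: B_def)
    ultimately obtain \<beta> where \<beta>: "\<beta> \<in> B" and min: "\<And>\<gamma>. \<gamma> \<in> B \<Longrightarrow> c \<bullet> \<beta> \<le> c \<bullet> \<gamma>"
      by (metis arg_min_if_finite(1) arg_min_least)
    then have \<beta>': "\<beta> \<in> \<Psi>" "0 < c \<bullet> \<beta>" "\<not> good \<beta>" by (auto simp: B_def)
    have "\<beta> \<notin> \<Delta>"
    proof
      assume "\<beta> \<in> \<Delta>"
      then have "good \<beta>" unfolding good_def by (intro exI[of _ "[\<beta>]"]) simp
      with \<beta>' show False by blast
    qed
    \<comment> \<open>\<open>\<beta>\<close> lies in the cone of the simple roots and pairs
      positively with itself.\<close>
    have "\<exists>\<delta>\<in>\<Delta>. 0 < \<beta> \<bullet> \<delta>"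
    proof (rule ccontr)
      assume "\<not> ?thesis"
      then have "0 \<le> (- \<beta>) \<bullet> \<beta>"
        using nonneg_span_inner_nonneg[OF pos_root_nonneg_span[OF \<beta>'(1,2)], of "- \<beta>"] by fastforce
      moreover have "0 < \<beta> \<bullet> \<beta>" using root_nonzero[OF \<beta>'(1)] by (simp del: inner_real_def)
      ultimately show False by simp
    qed
    then obtain \<delta> where \<delta>: "\<delta> \<in> \<Delta>" "0 < \<beta> \<bullet> \<delta>" by blast
    let ?\<gamma> = "root_reflection \<delta> \<beta>"
    have \<gamma>: "?\<gamma> \<in> \<Psi>" "0 < c \<bullet> ?\<gamma>"
      using reflect_root[OF simple_root[OF \<delta>(1)] \<beta>'(1)] simple_reflection_pos[OF \<delta>(1) \<beta>'(1,2)]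
        \<delta>(1) \<open>\<beta> \<notin> \<Delta>\<close> by auto
    have "\<delta> \<noteq> 0" using \<delta> by auto
    then have "c \<bullet> ?\<gamma> < c \<bullet> \<beta>"
      using \<delta> simple_pos[OF \<delta>(1)] by (simp add: root_reflection_def inner_diff_right)
    then have "good ?\<gamma>" using min \<gamma> by (force simp: B_def)
    then obtain ws where ws: "set ws \<subseteq> \<Delta>" "\<And>x. root_reflection ?\<gamma> x = reflect_word ws x"
      unfolding good_def by blast
    have "root_reflection \<beta> x = reflect_word (\<delta> # ws @ [\<delta>]) x" for x
      using root_reflection_conj[of \<delta> ?\<gamma> "root_reflection \<delta> x"] by (simp add: ws)
    moreover have "set (\<delta> # ws @ [\<delta>]) \<subseteq> \<Delta>" using ws \<delta> by auto
    ultimately show False using \<beta>'(3) good_def by blast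
  qed
  then have "good \<beta>"
  proof (cases "0 < c \<bullet> \<beta>")
    case False
    then have "0 < c \<bullet> (- \<beta>)" using regular[OF assms] by simp
    then have "good (- \<beta>)" using \<open>B = {}\<close> uminus_root[OF assms] by (auto simp: B_def)
    then show ?thesis by (simp add: good_def root_reflection_uminus)
  qed (use assms in \<open>auto simp: B_def\<close>)
  then show ?thesis using that good_def by blast
qed

lemma orbit_simple: "orbit \<Psi> x = orbit \<Delta> x"
proof
  show "orbit \<Psi> x \<subseteq> orbit \<Delta> x"
  proof
    fix y assume "y \<in> orbit \<Psi> x"
    then show "y \<in> orbit \<Delta> x"
    proof (induction rule: orbit_induct)
      case (step y a)
      then obtain ws where "set ws \<subseteq> \<Delta>" "\<And>x. root_reflection a x = reflect_word ws x"
        using reflection_simple_word[of a] by metis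
      then show ?case using orbit_reflect_word[of ws \<Delta> y x] step by simp
    qed (rule orbit_refl)
  qed
qed (simp add: orbit_mono simple_root subsetI)

lemma reflect_word_root:
  "set ws \<subseteq> \<Psi> \<Longrightarrow> \<beta> \<in> \<Psi> \<Longrightarrow> reflect_word ws \<beta> \<in> \<Psi>"
  by (induction ws) (auto intro: reflect_root)

text \<open>Reading from the right, look at the first letter that makes the root negative: a simple
  reflection does this to no positive root but its own.\<close>

lemma reflect_word_negative_split:
  assumes "set ws \<subseteq> \<Delta>" "\<beta> \<in> \<Psi>" "0 < c \<bullet> \<beta>" "c \<bullet> reflect_word ws \<beta> < 0"
  obtains us \<delta> vs where "ws = us @ \<delta> # vs" "reflect_word vs \<beta> = \<delta>"
  using assms(1,4)
proof (induction ws arbitrary: thesis)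
  case Nil
  then show ?case using assms by simp
next
  case (Cons a ws)
  have root: "reflect_word ws \<beta> \<in> \<Psi>"
    using Cons.prems assms simple_root by (intro reflect_word_root) auto
  show ?case
  proof (cases "c \<bullet> reflect_word ws \<beta> < 0")
    case True
    then show ?thesis using Cons by (metis append_Cons set_subset_Cons subset_trans)
  next
    case False
    then have "0 < c \<bullet> reflect_word ws \<beta>" using regular[OF root] by simp
    then have "reflect_word ws \<beta> = a"
      using simple_reflection_pos[of a, OF _ root] Cons.prems by fastforce
    then show ?thesis using Cons.prems(1)[of "[]" a ws] by simp
  qed
qed

section \<open>Dominant vectors and the maximum over an orbit\<close>

definition dominant :: "'a \<Rightarrow> bool" where
  "dominant x \<longleftrightarrow> (\<forall>\<delta>\<in>\<Delta>. 0 \<le> x \<bullet> \<delta>)"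

lemma dominant_pos_root: "dominant x \<Longrightarrow> \<beta> \<in> \<Psi> \<Longrightarrow> 0 < c \<bullet> \<beta> \<Longrightarrow> 0 \<le> x \<bullet> \<beta>"
  by (rule nonneg_span_inner_nonneg[OF pos_root_nonneg_span]) (auto simp: dominant_def)

lemma dominant_regular: "dominant c"
  using simple_pos by (auto simp: dominant_def less_imp_le)

text \<open>Exchange argument: a word moving one dominant vector to another either fixes it in its first
  step or can be shortened by two letters.\<close>

lemma dominant_word_fixed:
  assumes "set ws \<subseteq> \<Delta>" "dominant y" "dominant (reflect_word ws y)"
  shows "reflect_word ws y = y"
  using assms(1,3)
proof (induction "length ws" arbitrary: ws rule: less_induct)
  case less
  show ?case
  proof (cases ws rule: rev_cases)
    case (snoc vs \<delta>)
    have \<delta>: "\<delta> \<in> \<Delta>" "set vs \<subseteq> \<Delta>" using less.prems snoc by auto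
    let ?\<gamma> = "reflect_word vs \<delta>"
    have \<gamma>: "?\<gamma> \<in> \<Psi>" using \<delta> simple_root by (intro reflect_word_root) auto
    show ?thesis
    proof (cases "0 < c \<bullet> ?\<gamma>")
      case True
      have "0 \<le> reflect_word ws y \<bullet> ?\<gamma>" by (rule dominant_pos_root[OF less.prems(2) \<gamma> True])
      also have "\<dots> = root_reflection \<delta> y \<bullet> \<delta>" by (simp add: snoc inner_reflect_word)
      also have "\<dots> = - (y \<bullet> \<delta>)"
        using root_reflection_self[of \<delta>] root_nonzero \<delta> simple_root
        by (simp add: inner_root_reflection_commute)
      finally have "y \<bullet> \<delta> = 0" using assms(2) \<delta> by (force simp: dominant_def)
      then have "reflect_word ws y = reflect_word vs y" by (simp add: snoc root_reflection_eq_self)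
      then show ?thesis using less.hyps[of vs] less.prems \<delta> snoc by simp
    next
      case False
      then have "c \<bullet> ?\<gamma> < 0" using regular[OF \<gamma>] by simp
      then obtain us \<epsilon> us' where split: "vs = us @ \<epsilon> # us'" "reflect_word us' \<delta> = \<epsilon>"
        by (rule reflect_word_negative_split[OF \<delta>(2) simple_root[OF \<delta>(1)] simple_pos[OF \<delta>(1)]])
      \<comment> \<open>As \<open>us'\<close> sends \<open>\<delta>\<close> to
        \<open>\<epsilon>\<close>, moving the last letter to the left past \<open>us'\<close> turns
        it into \<open>\<epsilon>\<close>, which cancels against the \<open>\<epsilon>\<close>
        already there.\<close>
      have "reflect_word ws y = reflect_word (us @ us') y"
        using reflect_word_conj[of us' \<delta> y] by (simp add: snoc split)
      then show ?thesis using less.hyps[of "us @ us'"] less.prems snoc split by simp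
    qed
  qed simp
qed

text \<open>Among the orbit points that exceed \<open>x\<close> by a cone element, take one with the
  largest \<open>c\<close>-value; a simple reflection at a negative pairing would climb
  further.\<close>

lemma dominant_representative: obtains y where "y \<in> orbit \<Psi> x" "dominant y" "y - x \<in> nonneg_span \<Delta>"
proof -
  define T where "T = {v \<in> orbit \<Psi> x. v - x \<in> nonneg_span \<Delta>}"
  have "finite T" "x \<in> T" using finite_orbit orbit_refl by (auto simp: T_def nonneg_span_0)
  then obtain v where v: "v \<in> T" and max: "\<And>w. w \<in> T \<Longrightarrow> c \<bullet> w \<le> c \<bullet> v"
    using arg_min_if_finite(1)[of T "\<lambda>w. - (c \<bullet> w)"] arg_min_least[of T _ "\<lambda>w. - (c \<bullet> w)"]
    by (metis empty_iff neg_le_iff_le)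
  have "dominant v"
    unfolding dominant_def
  proof (rule ballI, rule ccontr)
    fix \<delta> assume \<delta>: "\<delta> \<in> \<Delta>" and neg: "\<not> 0 \<le> v \<bullet> \<delta>"
    define r where "r = - (2 * (v \<bullet> \<delta>) / (\<delta> \<bullet> \<delta>))"
    have "\<delta> \<noteq> 0" using neg by auto
    then have r: "0 < r" using neg by (simp add: r_def divide_neg_pos)
    have eq: "root_reflection \<delta> v = v + r *\<^sub>R \<delta>" by (simp add: root_reflection_def r_def)
    have "root_reflection \<delta> v - x = (v - x) + r *\<^sub>R \<delta>" by (simp add: eq)
    also have "\<dots> \<in> nonneg_span \<Delta>"
    proof (intro nonneg_span_add nonneg_span_scaleR)
      show "v - x \<in> nonneg_span \<Delta>" using v by (simp add: T_def)
      show "\<delta> \<in> nonneg_span \<Delta>" using \<delta> finite_simple by (simp add: nonneg_span_base)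
    qed (use r in simp)
    finally have "root_reflection \<delta> v \<in> T"
      using v orbit_root_reflection[OF simple_root[OF \<delta>]] by (simp add: T_def)
    then have "r * (c \<bullet> \<delta>) \<le> 0" using max by (force simp: eq inner_add_right)
    then show False using mult_pos_pos[OF r simple_pos[OF \<delta>]] by simp
  qed
  then show ?thesis using v that T_def by blast
qed

text \<open>The dominant representative of \<open>z\<close> is \<open>y\<close> itself, so
  \<open>y - z\<close> is in the cone, where a dominant vector is nonnegative.\<close>

lemma dominant_max:
  assumes "dominant u" "dominant y" "z \<in> orbit \<Psi> y" shows "u \<bullet> z \<le> u \<bullet> y"
proof -
  obtain v where v: "v \<in> orbit \<Psi> z" "dominant v" "v - z \<in> nonneg_span \<Delta>"
    using dominant_representative .
  then have "v \<in> orbit \<Delta> y" using orbit_trans[OF assms(3) v(1)] orbit_simple by simp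
  then obtain ws where "set ws \<subseteq> \<Delta>" "v = reflect_word ws y" by (auto simp: orbit_def)
  then have "v = y" using dominant_word_fixed[of ws y] assms(2) v(2) by simp
  then show ?thesis
    using nonneg_span_inner_nonneg[OF v(3), of u] assms by (auto simp: dominant_def inner_diff_right)
qed

end

section \<open>Deformations of orbit polytopes\<close>

lemma inner_le_convex_hull:
  assumes "y \<in> convex hull S" "\<And>z. z \<in> S \<Longrightarrow> u \<bullet> z \<le> b" shows "u \<bullet> y \<le> b"
proof -
  have "convex hull S \<subseteq> {z. u \<bullet> z \<le> b}"
    using assms(2) by (intro hull_minimal) (auto simp: convex_halfspace_le)
  then show ?thesis using assms(1) by blast
qed

lemma normal_cone_convex_hull: "normal_cone (convex hull S) {v} = {u. \<forall>y\<in>S. u \<bullet> y \<le> u \<bullet> v}"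
  by (auto simp: normal_cone_def hull_inc intro: inner_le_convex_hull)

text \<open>Coarsening need only be tested at vertices: a nonempty face has one, and its normal cone
  contains that of the face.\<close>

lemma deformation_of_convex_hullI:
  assumes "finite S" "polytope Q" "Q \<noteq> {}"
    and vertex: "\<And>v. v \<in> S \<Longrightarrow> \<exists>q\<in>Q. normal_cone (convex hull S) {v} \<subseteq> normal_cone Q {q}"
  shows "deformation_of (convex hull S) Q"
  unfolding deformation_of_def fan_coarsens_def
proof (intro conjI ballI assms(2,3))
  let ?P = "convex hull S"
  fix C assume "C \<in> normal_fan ?P"
  then obtain F where F: "F face_of ?P" "F \<noteq> {}" "C = normal_cone ?P F"
    unfolding normal_fan_def by blast
  have "compact F"
    by (meson F(1) face_of_imp_compact assms(1) compact_convex_hull convex_convex_hull finite_imp_compact)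
  then obtain v where v: "v extreme_point_of F"
    using extreme_point_exists_convex face_of_imp_convex F by blast
  have "v extreme_point_of ?P"
    using v F(1) extreme_point_of_face by blast
  then have "v \<in> S" by (rule extreme_point_of_convex_hull)
  then obtain q where q: "q \<in> Q" "normal_cone ?P {v} \<subseteq> normal_cone Q {q}" using vertex by blast
  have "v \<in> F" using v by (simp add: extreme_point_of_def)
  then have C: "C \<subseteq> normal_cone Q {q}" using q unfolding F(3) by (auto simp: normal_cone_def)
  \<comment> \<open>A fan consists of normal cones of faces, so the point \<open>q\<close> is
    replaced by the face on which all directions of \<open>C\<close> attain the same maximum as at
    \<open>q\<close>.\<close>
  define G where "G = {z\<in>Q. \<forall>u\<in>C. u \<bullet> z = u \<bullet> q}"
  have max: "u \<bullet> y \<le> u \<bullet> q" if "u \<in> C" "y \<in> Q" for u y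
    using C that by (auto simp: normal_cone_def)
  have "G face_of Q"
  proof (cases "C = {}")
    case True
    then show ?thesis using assms(2) by (simp add: G_def polytope_imp_convex face_of_refl)
  next
    case False
    have "G = (\<Inter>u\<in>C. Q \<inter> {z. u \<bullet> z = u \<bullet> q})" using False by (auto simp: G_def)
    also have "\<dots> face_of Q"
      using False assms(2) max
      by (intro face_of_Inter) (auto intro!: face_of_Int_supporting_hyperplane_le polytope_imp_convex)
    finally show ?thesis .
  qed
  moreover have "q \<in> G" using q by (simp add: G_def)
  moreover have "C \<subseteq> normal_cone Q G" using max by (auto simp: normal_cone_def G_def)
  ultimately show "\<exists>C'\<in>normal_fan Q. C \<subseteq> C'" unfolding normal_fan_def by blast
qed

lemma deformation_of_vertex:
  assumes "deformation_of P Q" "{v} face_of P"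
  obtains q where "q \<in> Q" "normal_cone P {v} \<subseteq> normal_cone Q {q}"
proof -
  have "normal_cone P {v} \<in> normal_fan P" using assms(2) unfolding normal_fan_def by blast
  then obtain F where F: "F face_of Q" "F \<noteq> {}" "normal_cone P {v} \<subseteq> normal_cone Q F"
    using assms(1) unfolding deformation_of_def fan_coarsens_def normal_fan_def by blast
  then obtain q where "q \<in> F" by blast
  then have "normal_cone Q F \<subseteq> normal_cone Q {q}" "q \<in> Q"
    using face_of_imp_subset[OF F(1)] unfolding normal_cone_def by blast+
  with F that show ?thesis by blast
qed

text \<open>Within the ball of radius \<open>norm v\<close>, the functional \<open>inner v\<close>
  attains its maximum \<open>v \<bullet> v\<close> at \<open>v\<close> only.\<close>

lemma sphere_point_face:
  fixes S :: "'a::euclidean_space set"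
  assumes "v \<in> S" "\<And>z. z \<in> S \<Longrightarrow> norm z \<le> norm v"
  shows "{v} face_of convex hull S"
proof -
  have le: "v \<bullet> z \<le> v \<bullet> v" if "z \<in> convex hull S" for z
  proof (rule inner_le_convex_hull[OF that])
    fix z assume "z \<in> S"
    have "v \<bullet> z \<le> norm v * norm z" by (rule norm_cauchy_schwarz)
    also have "\<dots> \<le> norm v * norm v" using assms(2)[OF \<open>z \<in> S\<close>] by (simp add: mult_left_mono)
    finally show "v \<bullet> z \<le> v \<bullet> v" by (simp add: power2_norm_eq_inner flip: power2_eq_square)
  qed
  have "convex hull S \<subseteq> cball 0 (norm v)"
    using assms(2) by (intro hull_minimal) auto
  then have norm: "norm z \<le> norm v" if "z \<in> convex hull S" for z using that by auto
  have "convex hull S \<inter> {z. v \<bullet> z = v \<bullet> v} = {v}"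
  proof (intro equalityI subsetI)
    fix z assume z: "z \<in> convex hull S \<inter> {z. v \<bullet> z = v \<bullet> v}"
    have "(norm z)\<^sup>2 \<le> (norm v)\<^sup>2" using norm z by (intro power_mono) auto
    then have "(z - v) \<bullet> (z - v) \<le> 0"
      using z by (simp add: inner_diff_left inner_diff_right inner_commute power2_norm_eq_inner)
    then have "(z - v) \<bullet> (z - v) = 0" using inner_ge_zero[of "z - v"] by (rule order_antisym)
    then show "z \<in> {v}" by simp
  qed (use assms(1) hull_inc in auto)
  then show ?thesis
    using face_of_Int_supporting_hyperplane_le[of "convex hull S" v "v \<bullet> v"] le by simp
qed

section \<open>Support functions of orbit polytopes\<close>

context root_base
begin

lemma polytope_orbit: "polytope (convex hull (orbit \<Psi> x))"
  using finite_orbit polytope_def by blast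

lemma dominant_max_reflect_word:
  assumes "dominant u" "dominant y" "set ws \<subseteq> \<Psi>" "p \<in> convex hull (orbit \<Psi> y)"
  shows "reflect_word ws u \<bullet> p \<le> u \<bullet> y"
proof (rule inner_le_convex_hull[OF assms(4)])
  fix z assume "z \<in> orbit \<Psi> y"
  then have "reflect_word (rev ws) z \<in> orbit \<Psi> y" using assms(3) by (intro orbit_reflect_word) auto
  then show "reflect_word ws u \<bullet> z \<le> u \<bullet> y"
    using dominant_max assms(1,2) by (simp add: inner_reflect_word_commute)
qed

text \<open>Support functions add up: the maximum over the orbit of \<open>x\<close> is the sum of
  the maxima for \<open>y\<close> and \<open>x - y\<close>. A direction maximal at
  \<open>reflect_word ws x\<close> is thus maximal at \<open>reflect_word ws y\<close>, since
  neither part can exceed its own maximum.\<close>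

lemma deformation_of_dominant_summand:
  assumes "dominant x" "dominant y" "dominant (x - y)"
  shows "deformation_of (convex hull (orbit \<Psi> x)) (convex hull (orbit \<Psi> y))"
proof (rule deformation_of_convex_hullI[OF finite_orbit polytope_orbit])
  show "convex hull orbit \<Psi> y \<noteq> {}" using orbit_refl hull_inc by fastforce
  fix v assume "v \<in> orbit \<Psi> x"
  then obtain ws where ws: "set ws \<subseteq> \<Psi>" and v: "v = reflect_word ws x" by (auto simp: orbit_def)
  let ?q = "reflect_word ws y"
  have "?q \<in> convex hull orbit \<Psi> y" using ws by (intro hull_inc orbitI)
  moreover have "u \<bullet> z \<le> u \<bullet> ?q"
    if u: "\<forall>z\<in>orbit \<Psi> x. u \<bullet> z \<le> u \<bullet> v" and z: "z \<in> orbit \<Psi> y" for u z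
  proof -
    obtain u0 where "u0 \<in> orbit \<Psi> (reflect_word (rev ws) u)" and u0: "dominant u0"
      using dominant_representative by metis
    then obtain vs where vs: "set vs \<subseteq> \<Psi>" "u0 = reflect_word vs (reflect_word (rev ws) u)"
      by (auto simp: orbit_def)
    let ?w = "ws @ rev vs"
    have w: "set ?w \<subseteq> \<Psi>" and u': "u = reflect_word ?w u0" using ws vs by auto
    have le: "u \<bullet> reflect_word ws y' \<le> u0 \<bullet> y'" if "dominant y'" for y'
      unfolding u' by (rule dominant_max_reflect_word[OF u0 that w])
        (use ws in \<open>intro hull_inc orbitI\<close>)
    have "reflect_word ?w x \<in> orbit \<Psi> x" using w by (rule orbitI)
    then have "u \<bullet> reflect_word ?w x \<le> u \<bullet> v" using u by blast
    then have "u0 \<bullet> x \<le> u \<bullet> reflect_word ws x"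
      unfolding v by (subst (asm) u') (simp only: inner_reflect_word)
    moreover have "u0 \<bullet> x = u0 \<bullet> y + u0 \<bullet> (x - y)"
      "u \<bullet> reflect_word ws x = u \<bullet> reflect_word ws y + u \<bullet> reflect_word ws (x - y)"
      by (simp_all add: reflect_word_diff inner_diff_right)
    ultimately have "u0 \<bullet> y \<le> u \<bullet> ?q" using le[OF assms(3)] by simp
    moreover have "u \<bullet> z \<le> u0 \<bullet> y"
      unfolding u' by (rule dominant_max_reflect_word[OF u0 assms(2) w hull_inc[OF z]])
    ultimately show ?thesis by simp
  qed
  ultimately show "\<exists>q\<in>convex hull orbit \<Psi> y.
      normal_cone (convex hull orbit \<Psi> x) {v} \<subseteq> normal_cone (convex hull orbit \<Psi> y) {q}"
    unfolding normal_cone_convex_hull by blast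
qed

text \<open>\<open>c\<close> is strictly positive on \<open>\<Delta>\<close>, so a large multiple
  corrects any vector. Hence a functional that vanishes on dominant vectors is 0.\<close>

lemma dominant_shift: obtains N where "dominant (e + N *\<^sub>R c)"
proof
  define N where "N = (\<Sum>\<delta>\<in>\<Delta>. \<bar>e \<bullet> \<delta>\<bar> / (c \<bullet> \<delta>))"
  show "dominant (e + N *\<^sub>R c)"
    unfolding dominant_def
  proof
    fix \<delta> assume \<delta>: "\<delta> \<in> \<Delta>"
    have "\<bar>e \<bullet> \<delta>\<bar> / (c \<bullet> \<delta>) \<le> N"
      unfolding N_def using finite_simple \<delta> simple_pos
      by (intro member_le_sum[where f = "\<lambda>\<delta>. \<bar>e \<bullet> \<delta>\<bar> / (c \<bullet> \<delta>)"]) (auto simp: less_imp_le)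
    then have "\<bar>e \<bullet> \<delta>\<bar> \<le> N * (c \<bullet> \<delta>)" using simple_pos[OF \<delta>] by (simp add: divide_le_eq)
    then show "0 \<le> (e + N *\<^sub>R c) \<bullet> \<delta>" by (simp add: inner_add_left)
  qed
qed

text \<open>Comparing support functions in all images of a direction shows that \<open>t\<close> is
  invariant under the reflections. Only pairings with roots can be compared: if
  \<open>\<Psi>\<close> does not span, a translation orthogonal to it remains possible.\<close>

lemma homothetic_orbit_polytopes:
  assumes "dominant x" "dominant y" "0 \<le> r"
    and eq: "convex hull (orbit \<Psi> y) = (\<lambda>p. t + r *\<^sub>R p) ` (convex hull (orbit \<Psi> x))"
    and "\<beta> \<in> \<Psi>"
  shows "y \<bullet> \<beta> = r * (x \<bullet> \<beta>)"
proof -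
  have support: "reflect_word ws u \<bullet> t = u \<bullet> (y - r *\<^sub>R x)" if "dominant u" "set ws \<subseteq> \<Psi>" for u ws
  proof (rule order_antisym)
    have "t + r *\<^sub>R reflect_word ws x \<in> convex hull (orbit \<Psi> y)"
      unfolding eq using that by (intro imageI hull_inc orbitI)
    from dominant_max_reflect_word[OF that(1) assms(2) that(2) this]
    show "reflect_word ws u \<bullet> t \<le> u \<bullet> (y - r *\<^sub>R x)"
      by (simp add: inner_add_right inner_diff_right inner_reflect_word)
    have "reflect_word ws y \<in> convex hull (orbit \<Psi> y)"
      using that by (intro hull_inc orbitI)
    then obtain p where p: "p \<in> convex hull (orbit \<Psi> x)" "reflect_word ws y = t + r *\<^sub>R p"
      unfolding eq by blast
    have "u \<bullet> y = reflect_word ws u \<bullet> reflect_word ws y" by (simp add: inner_reflect_word)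
    also have "\<dots> = reflect_word ws u \<bullet> t + r * (reflect_word ws u \<bullet> p)"
      by (simp add: p(2) inner_add_right)
    also have "\<dots> \<le> reflect_word ws u \<bullet> t + r * (u \<bullet> x)"
      using dominant_max_reflect_word[OF that(1) assms(1) that(2) p(1)] assms(3)
      by (simp add: mult_left_mono)
    finally show "u \<bullet> (y - r *\<^sub>R x) \<le> reflect_word ws u \<bullet> t"
      by (simp add: inner_diff_right)
  qed
  define e where "e = y - r *\<^sub>R x - t"
  have e: "u \<bullet> e = 0" if "dominant u" for u
    using support[OF that, of "[]"] by (simp add: e_def inner_diff_right)
  obtain N where "dominant (e + N *\<^sub>R c)" by (rule dominant_shift)
  \<comment> \<open>Since \<open>c \<bullet> e = 0\<close>, the shifted vector pairs with
    \<open>e\<close> to \<open>e \<bullet> e\<close>.\<close>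
  from e[OF this] e[OF dominant_regular] have "e = 0" by (simp add: inner_add_left)
  have "root_reflection \<beta> c \<bullet> t = c \<bullet> t"
    using support[OF dominant_regular, of "[\<beta>]"] support[OF dominant_regular, of "[]"] assms(5) by simp
  then have "(c \<bullet> \<beta>) * (\<beta> \<bullet> t) = 0"
    using root_nonzero[OF assms(5)] by (simp add: root_reflection_def inner_diff_left)
  then have "t \<bullet> \<beta> = 0" using regular[OF assms(5)] by (simp add: inner_commute)
  moreover have "y = r *\<^sub>R x + t" using \<open>e = 0\<close> by (simp add: e_def algebra_simps)
  ultimately show ?thesis by (simp add: inner_add_left)
qed

text \<open>\<open>\<gamma>\<close> would force the homothety ratio to be 0, and
  \<open>\<gamma>'\<close> forbids that.\<close>

lemma not_indecomposable_orbit: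
  assumes "dominant x" "dominant y" "dominant (x - y)"
    and "\<gamma> \<in> \<Delta>" "0 < x \<bullet> \<gamma>" "y \<bullet> \<gamma> = 0" and "\<gamma>' \<in> \<Delta>" "0 < y \<bullet> \<gamma>'"
  shows "\<not> indecomposable (convex hull (orbit \<Psi> x))"
proof
  assume "indecomposable (convex hull (orbit \<Psi> x))"
  with deformation_of_dominant_summand[OF assms(1-3)] obtain r t where "0 \<le> r"
    "convex hull (orbit \<Psi> y) = (\<lambda>p. t + r *\<^sub>R p) ` (convex hull (orbit \<Psi> x))"
    unfolding indecomposable_def by blast
  from homothetic_orbit_polytopes[OF assms(1,2) this] have "y \<bullet> \<beta> = r * (x \<bullet> \<beta>)" if "\<beta> \<in> \<Delta>" for \<beta>
    using simple_root that by blast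
  from this[OF assms(4)] this[OF assms(7)] show False using assms(5,6,8) by simp
qed

end

section \<open>The Weyl group\<close>

lemma carrier_BijGroup_UNIV: "carrier (BijGroup UNIV) = {f. bij f}"
  by (auto simp: BijGroup_def Bij_def)

lemma mult_BijGroup_UNIV: "bij f \<Longrightarrow> bij g \<Longrightarrow> f \<otimes>\<^bsub>BijGroup UNIV\<^esub> g = f \<circ> g"
  by (auto simp: BijGroup_def Bij_def compose_def)

lemma one_BijGroup_UNIV: "\<one>\<^bsub>BijGroup UNIV\<^esub> = id"
  by (auto simp: BijGroup_def)

lemma bij_root_reflection: "bij (root_reflection a)"
  by (rule involuntory_imp_bij) simp

lemma bij_reflect_word: "bij (reflect_word ws)"
  by (rule o_bij[of "reflect_word (rev ws)"]) auto

text \<open>Reflections are involutions, so inverses of generators are generators and words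
  suffice.\<close>

lemma weyl_group_words: "weyl_group \<Phi> = {reflect_word ws | ws. set ws \<subseteq> \<Phi>}"
proof (intro equalityI subsetI)
  interpret group "BijGroup (UNIV :: 'a set)" by (rule group_BijGroup)
  fix w assume "w \<in> weyl_group \<Phi>"
  then have "\<exists>ws. set ws \<subseteq> \<Phi> \<and> w = reflect_word ws"
    unfolding weyl_group_def
  proof (induction rule: generate.induct)
    case one
    show ?case by (intro exI[of _ "[]"]) (auto simp: one_BijGroup_UNIV)
  next
    case (incl h)
    then obtain a where "a \<in> \<Phi>" "h = root_reflection a" by blast
    then show ?case by (intro exI[of _ "[a]"]) auto
  next
    case (inv h)
    then obtain a where a: "a \<in> \<Phi>" "h = root_reflection a" by blast
    have "inv\<^bsub>BijGroup UNIV\<^esub> root_reflection a = root_reflection a"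
      by (rule inv_equality)
        (auto simp: carrier_BijGroup_UNIV bij_root_reflection mult_BijGroup_UNIV one_BijGroup_UNIV)
    with a show ?case by (intro exI[of _ "[a]"]) auto
  next
    case (eng h1 h2)
    then obtain ws1 ws2 where "set ws1 \<subseteq> \<Phi>" "h1 = reflect_word ws1" "set ws2 \<subseteq> \<Phi>" "h2 = reflect_word ws2"
      by blast
    then show ?case
      by (intro exI[of _ "ws1 @ ws2"]) (auto simp: mult_BijGroup_UNIV bij_reflect_word)
  qed
  then show "w \<in> {reflect_word ws | ws. set ws \<subseteq> \<Phi>}" by blast
next
  fix w assume "w \<in> {reflect_word ws | ws. set ws \<subseteq> \<Phi>}"
  then obtain ws where "set ws \<subseteq> \<Phi>" "w = reflect_word ws" by blast
  moreover have "set ws \<subseteq> \<Phi> \<Longrightarrow> reflect_word ws \<in> weyl_group \<Phi>" for ws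
  proof (induction ws)
    case Nil
    have "reflect_word [] = (id :: 'a \<Rightarrow> 'a)" by auto
    then show ?case unfolding weyl_group_def one_BijGroup_UNIV[symmetric] by (simp add: generate.one)
  next
    case (Cons a ws)
    then have "root_reflection a \<otimes>\<^bsub>BijGroup UNIV\<^esub> reflect_word ws \<in> weyl_group \<Phi>"
      unfolding weyl_group_def by (auto intro!: generate.eng intro: generate.incl)
    moreover have "root_reflection a \<otimes>\<^bsub>BijGroup UNIV\<^esub> reflect_word ws = reflect_word (a # ws)"
      by (auto simp: mult_BijGroup_UNIV bij_reflect_word bij_root_reflection)
    ultimately show ?case by metis
  qed
  ultimately show "w \<in> weyl_group \<Phi>" by blast
qed

lemma weight_polytope_orbit: "weight_polytope \<Phi> x = convex hull (orbit \<Phi> x)"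
proof -
  have "(\<lambda>w. w x) ` weyl_group \<Phi> = orbit \<Phi> x" by (auto simp: weyl_group_words orbit_def)
  then show ?thesis by (simp add: weight_polytope_def)
qed

text \<open>A word acts on \<open>\<Phi>\<close>, and this action determines it because \<open>\<Phi>\<close> spans.\<close>

lemma finite_orbit_spanning:
  assumes "finite \<Phi>" "span \<Phi> = UNIV" "\<And>\<alpha>. \<alpha> \<in> \<Phi> \<Longrightarrow> root_reflection \<alpha> ` \<Phi> \<subseteq> \<Phi>"
  shows "finite (orbit \<Phi> x)"
proof -
  let ?W = "{reflect_word ws | ws. set ws \<subseteq> \<Phi>}"
  have "reflect_word ws \<beta> \<in> \<Phi>" if "set ws \<subseteq> \<Phi>" "\<beta> \<in> \<Phi>" for ws \<beta>
    using that(1)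
  proof (induction ws)
    case (Cons a ws)
    then show ?case using assms(3)[of a] by auto
  qed (use that in simp)
  then have "(\<lambda>w. restrict w \<Phi>) ` ?W \<subseteq> \<Phi> \<rightarrow>\<^sub>E \<Phi>" by auto
  then have fin: "finite ((\<lambda>w. restrict w \<Phi>) ` ?W)"
    by (rule finite_subset) (simp add: finite_PiE assms(1))
  have "inj_on (\<lambda>w. restrict w \<Phi>) ?W"
  proof (rule inj_onI)
    fix v w assume vw: "v \<in> ?W" "w \<in> ?W" "restrict v \<Phi> = restrict w \<Phi>"
    then have "\<And>\<beta>. \<beta> \<in> \<Phi> \<Longrightarrow> v \<beta> = w \<beta>" by (metis restrict_apply')
    moreover have "linear v" "linear w" using vw linear_reflect_word by auto
    ultimately show "v = w" using linear_eq_on_span[of v w \<Phi>] assms(2) by blast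
  qed
  with fin have "finite ?W" by (rule finite_imageD)
  moreover have "orbit \<Phi> x = (\<lambda>w. w x) ` ?W" by (auto simp: orbit_def)
  ultimately show ?thesis by simp
qed

section \<open>Chambers\<close>

text \<open>The open sign cone of \<open>x0\<close> is convex and avoids all hyperplanes;
  conversely, a connected set avoiding them cannot change the sign of any root. Sign products spare
  a choice of positive roots.\<close>

lemma chamber_sign_cone:
  assumes "finite \<Phi>" "chamber \<Phi> D"
  obtains x0 where "\<And>\<beta>. \<beta> \<in> \<Phi> \<Longrightarrow> x0 \<bullet> \<beta> \<noteq> 0" "D = {x. \<forall>\<beta>\<in>\<Phi>. 0 \<le> (x0 \<bullet> \<beta>) * (x \<bullet> \<beta>)}"
proof -
  define U where "U = {x. \<forall>\<beta>\<in>\<Phi>. x \<bullet> \<beta> \<noteq> 0}"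
  have "UNIV - (\<Union>\<alpha>\<in>\<Phi>. {x. x \<bullet> \<alpha> = 0}) = U" by (auto simp: U_def)
  then obtain K where K: "K \<in> components U" and D: "D = closure K"
    using assms(2) unfolding chamber_def by metis
  then obtain x0 where x0: "x0 \<in> K" using in_components_nonempty by blast
  have KU: "K \<subseteq> U" using K in_components_subset by blast
  then have reg: "x0 \<bullet> \<beta> \<noteq> 0" if "\<beta> \<in> \<Phi>" for \<beta> using that x0 by (auto simp: U_def)
  define C where "C = {x. \<forall>\<beta>\<in>\<Phi>. 0 < (x0 \<bullet> \<beta>) * (x \<bullet> \<beta>)}"
  define E where "E = {x. \<forall>\<beta>\<in>\<Phi>. 0 \<le> (x0 \<bullet> \<beta>) * (x \<bullet> \<beta>)}"
  have C: "C = (\<Inter>\<beta>\<in>\<Phi>. {x. ((x0 \<bullet> \<beta>) *\<^sub>R \<beta>) \<bullet> x > 0})"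
    and E: "E = (\<Inter>\<beta>\<in>\<Phi>. {x. ((x0 \<bullet> \<beta>) *\<^sub>R \<beta>) \<bullet> x \<ge> 0})"
    by (auto simp: C_def E_def inner_commute)
  have "convex C" unfolding C by (intro convex_INT convex_halfspace_gt)
  then have "connected C" by (rule convex_connected)
  moreover have "C \<subseteq> U" by (auto simp: C_def U_def)
  moreover have "x0 \<in> C" using reg by (auto simp: C_def zero_less_mult_iff linorder_neq_iff)
  ultimately have "C \<subseteq> K" using components_maximal[OF K, of C] x0 by blast
  moreover have "K \<subseteq> C"
  proof
    fix x assume x: "x \<in> K"
    have "connected K" using K in_components_connected by blast
    have "0 < (x0 \<bullet> \<beta>) * (x \<bullet> \<beta>)" if \<beta>: "\<beta> \<in> \<Phi>" for \<beta>
    proof (rule ccontr)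
      assume "\<not> ?thesis"
      then have "\<beta> \<bullet> x0 \<le> 0 \<and> 0 \<le> \<beta> \<bullet> x \<or> \<beta> \<bullet> x \<le> 0 \<and> 0 \<le> \<beta> \<bullet> x0"
        by (auto simp: zero_less_mult_iff inner_commute not_less linorder_not_less)
      then obtain z where "z \<in> K" "\<beta> \<bullet> z = 0"
        using connected_ivt_hyperplane[OF \<open>connected K\<close>] x x0 by meson
      then show False using KU \<beta> by (auto simp: U_def inner_commute)
    qed
    then show "x \<in> C" by (simp add: C_def)
  qed
  ultimately have "K = C" by blast
  have "closed E" unfolding E by (intro closed_INT ballI closed_halfspace_ge)
  moreover have "C \<subseteq> E" by (auto simp: C_def E_def less_imp_le)
  ultimately have "closure C \<subseteq> E" by (rule closure_minimal[rotated])
  moreover have "E \<subseteq> closure C"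
  proof
    fix x assume x: "x \<in> E"
    show "x \<in> closure C"
      unfolding closure_approachable
    proof (intro allI impI)
      fix e :: real assume e: "0 < e"
      \<comment> \<open>Small enough for the shift along \<open>x0\<close> to stay within
        \<open>e\<close>; the added 1 covers \<open>x0 = 0\<close>.\<close>
      define t where "t = e / (2 * (norm x0 + 1))"
      have pos: "0 < norm x0 + 1" using norm_ge_zero[of x0] by linarith
      then have t: "0 < t" using e by (simp add: t_def)
      have "t * norm x0 \<le> t * (norm x0 + 1)" using t by simp
      also have "\<dots> = e / 2" using pos by (simp add: t_def field_simps)
      also have "\<dots> < e" using e by simp
      finally have "dist (x + t *\<^sub>R x0) x < e" using t by (simp add: dist_norm)
      moreover have "0 < (x0 \<bullet> \<beta>) * ((x + t *\<^sub>R x0) \<bullet> \<beta>)" if "\<beta> \<in> \<Phi>" for \<beta>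
      proof -
        have "0 < t * ((x0 \<bullet> \<beta>) * (x0 \<bullet> \<beta>))"
          using t reg[OF that] by (auto simp: zero_less_mult_iff linorder_neq_iff)
        moreover have "0 \<le> (x0 \<bullet> \<beta>) * (x \<bullet> \<beta>)" using x that by (simp add: E_def)
        ultimately show ?thesis by (simp add: inner_add_left algebra_simps)
      qed
      ultimately show "\<exists>y\<in>C. dist y x < e" unfolding C_def by blast
    qed
  qed
  ultimately have "D = E" using D \<open>K = C\<close> by blast
  then show ?thesis using that reg unfolding E_def by blast
qed

text \<open>Turns the definition of simple roots by facets into an inequality description of the
  chamber. A segment from \<open>x0\<close> to an outside point leaves \<open>D\<close> on a facet
  cut out by a simple root, yet every simple root is still positive at the exit point
  \<open>z\<close>.\<close>

lemma chamber_simple_halfspaces: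
  assumes "finite \<Phi>" "\<And>\<beta>. \<beta> \<in> \<Phi> \<Longrightarrow> - \<beta> \<in> \<Phi>" "chamber \<Phi> D"
    and y: "\<And>\<alpha>. \<alpha> \<in> simple_roots \<Phi> D \<Longrightarrow> 0 \<le> y \<bullet> \<alpha>"
  shows "y \<in> D"
proof (rule ccontr)
  assume "y \<notin> D"
  obtain x0 where reg: "\<And>\<beta>. \<beta> \<in> \<Phi> \<Longrightarrow> x0 \<bullet> \<beta> \<noteq> 0"
    and D: "D = {x. \<forall>\<beta>\<in>\<Phi>. 0 \<le> (x0 \<bullet> \<beta>) * (x \<bullet> \<beta>)}"
    using chamber_sign_cone[OF assms(1,3)] by metis
  have x0D: "x0 \<in> D" by (auto simp: D)
  have D': "D = (\<Inter>\<beta>\<in>\<Phi>. {x. ((x0 \<bullet> \<beta>) *\<^sub>R \<beta>) \<bullet> x \<ge> 0})"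
    by (auto simp: D inner_commute)
  have poly: "polyhedron D"
    unfolding D' by (rule polyhedron_Inter) (use assms(1) in \<open>auto simp: polyhedron_halfspace_ge simp del: inner_scaleR_left\<close>)
  define C where "C = (\<Inter>\<beta>\<in>\<Phi>. {x. ((x0 \<bullet> \<beta>) *\<^sub>R \<beta>) \<bullet> x > 0})"
  have "open C" unfolding C_def using assms(1) by (intro open_INT ballI open_halfspace_gt)
  moreover have CD: "C \<subseteq> D" by (auto simp: C_def D' less_imp_le)
  ultimately have Cint: "C \<subseteq> interior D" by (rule interior_maximal[rotated])
  have "x0 \<in> C" using reg by (auto simp: C_def zero_less_mult_iff linorder_neq_iff inner_commute)
  then have int_ne: "interior D \<noteq> {}" using Cint by blast
  then have rel_int: "rel_interior D = interior D" by (rule rel_interior_nonempty_interior)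
  have "closed_segment x0 y \<inter> frontier D \<noteq> {}"
    using x0D \<open>y \<notin> D\<close> by (intro connected_Int_frontier) auto
  then obtain z where "z \<in> closed_segment x0 y" and "z \<in> frontier D" by blast
  moreover from this obtain t where t: "0 \<le> t" "t \<le> 1" "z = (1 - t) *\<^sub>R x0 + t *\<^sub>R y"
    unfolding in_segment by blast
  moreover have "closed D" using poly by (rule polyhedron_imp_closed)
  ultimately have z: "z \<in> D - rel_interior D"
    by (simp add: frontier_def rel_int)
  then have "t < 1" using t \<open>y \<notin> D\<close> by (cases "t = 1") auto
  have zpos: "0 < z \<bullet> \<alpha>" if "\<alpha> \<in> simple_roots \<Phi> D" for \<alpha>
  proof -
    have "0 \<le> x0 \<bullet> \<alpha>" "x0 \<bullet> \<alpha> \<noteq> 0" using that x0D reg by (auto simp: simple_roots_def)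
    then have "0 < (1 - t) * (x0 \<bullet> \<alpha>)" "0 \<le> t * (y \<bullet> \<alpha>)"
      using \<open>t < 1\<close> t y[OF that] by auto
    then show ?thesis by (simp add: t inner_add_left)
  qed
  obtain F where F: "F facet_of D" "z \<in> F"
    using z rel_boundary_of_polyhedron[OF poly] by auto
  have F': "F face_of D" "F \<noteq> {}" "aff_dim F = aff_dim D - 1" using F by (auto simp: facet_of_def)
  \<comment> \<open>A relative interior point ensures that a root hyperplane through it contains the
    whole facet.\<close>
  then obtain p where p: "p \<in> rel_interior F"
    using rel_interior_eq_empty face_of_imp_convex by blast
  have "F \<noteq> D" using F by auto
  then have "p \<in> D - rel_interior D"
    using p face_of_subset_rel_boundary[OF F'(1)] rel_interior_subset by blast
  then have "p \<in> D" "p \<notin> C" using Cint rel_int by auto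
  from \<open>p \<notin> C\<close> obtain \<beta>' where \<beta>': "\<beta>' \<in> \<Phi>" "(x0 \<bullet> \<beta>') * (p \<bullet> \<beta>') \<le> 0"
    by (auto simp: C_def not_less inner_commute[of p])
  moreover have "0 \<le> (x0 \<bullet> \<beta>') * (p \<bullet> \<beta>')" using \<open>p \<in> D\<close> \<beta>'(1) by (simp add: D)
  ultimately have "p \<bullet> \<beta>' = 0" using reg[OF \<beta>'(1)] by simp
  then obtain \<beta> where \<beta>: "\<beta> \<in> \<Phi>" "0 < x0 \<bullet> \<beta>" "p \<bullet> \<beta> = 0"
    using reg[OF \<beta>'(1)] assms(2)[OF \<beta>'(1)] \<beta>'(1) that[of \<beta>'] that[of "- \<beta>'"]
    by (cases "0 < x0 \<bullet> \<beta>'") auto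
  have Dpos: "0 \<le> x \<bullet> \<beta>" if "x \<in> D" for x
    using that \<beta> by (force simp: D zero_le_mult_iff)
  define G where "G = D \<inter> {x. \<beta> \<bullet> x = 0}"
  have G: "G face_of D"
    unfolding G_def using poly Dpos
    by (intro face_of_Int_supporting_hyperplane_ge) (auto simp: polyhedron_imp_convex inner_commute)
  have "F \<subseteq> G"
    using subset_of_face_of[OF G face_of_imp_subset[OF F'(1)]] p \<beta>(3) \<open>p \<in> D\<close>
    by (force simp: G_def inner_commute)
  have "x0 \<notin> G" using \<beta>(2) by (simp add: G_def inner_commute)
  then have "G \<noteq> D" using x0D by blast
  then have "aff_dim G < aff_dim D"
    using face_of_aff_dim_lt[OF _ G] poly polyhedron_imp_convex by blast
  have "F face_of G"
    using face_of_subset[OF F'(1) \<open>F \<subseteq> G\<close>] face_of_imp_subset[OF G] by blast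
  \<comment> \<open>A facet contained in a proper face equals it, by dimension.\<close>
  then have "F = G"
    using face_of_aff_dim_lt[of G F] G face_of_imp_convex \<open>aff_dim G < aff_dim D\<close> F'(3) by force
  then have "{x\<in>D. x \<bullet> \<beta> = 0} facet_of D"
    using F(1) by (simp add: G_def inner_commute Int_def)
  then have "\<beta> \<in> simple_roots \<Phi> D" using \<beta> Dpos by (simp add: simple_roots_def)
  moreover have "z \<bullet> \<beta> = 0" using F(2) \<open>F = G\<close> by (simp add: G_def inner_commute)
  ultimately show False using zpos by force
qed

section \<open>Orders of products of two reflections\<close>

lemma pow_BijGroup_UNIV: "bij f \<Longrightarrow> f [^]\<^bsub>BijGroup UNIV\<^esub> (n::nat) = f ^^ n"
proof (induction n)
  case 0
  then show ?case by (simp add: one_BijGroup_UNIV)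
next
  case (Suc n)
  then show ?case
    by (simp add: mult_BijGroup_UNIV bij_fn funpow_Suc_right del: funpow.simps)
qed

text \<open>\<open>L\<close> and \<open>M\<close> are the two Cartan numbers of the pair. Their
  product is four times the squared cosine of the angle and decides the order of the product of the
  reflections.\<close>

locale root_pair =
  fixes a b :: "'a::euclidean_space" and L M :: real
  assumes nonzero: "a \<noteq> 0" "b \<noteq> 0"
    and not_parallel: "\<And>r. b \<noteq> r *\<^sub>R a"
    and L: "L = 2 * (a \<bullet> b) / (b \<bullet> b)"
    and M: "M = 2 * (a \<bullet> b) / (a \<bullet> a)"
begin

definition g :: "'a \<Rightarrow> 'a" where "g x = root_reflection a (root_reflection b x)"

definition p :: "'a \<Rightarrow> real" where "p x = 2 * (x \<bullet> a) / (a \<bullet> a)"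

definition q :: "'a \<Rightarrow> real" where "q x = 2 * (x \<bullet> b) / (b \<bullet> b)"

lemma p_shift: "p (x + A *\<^sub>R a + B *\<^sub>R b) = p x + 2 * A + M * B"
  using nonzero by (simp add: p_def M inner_add_left add_divide_distrib distrib_left inner_commute[of b a])

lemma q_shift: "q (x + A *\<^sub>R a + B *\<^sub>R b) = q x + L * A + 2 * B"
  using nonzero by (simp add: q_def L inner_add_left add_divide_distrib distrib_left)

lemma p_q_right: "p b = M" "q b = 2"
  using nonzero by (simp_all add: p_def q_def M inner_commute)

lemma g_eq: "g x = x + (M * q x - p x) *\<^sub>R a + (- q x) *\<^sub>R b"
proof -
  have b: "root_reflection b x = x + 0 *\<^sub>R a + (- q x) *\<^sub>R b" by (simp add: root_reflection_def q_def)
  have "g x = root_reflection b x - p (root_reflection b x) *\<^sub>R a"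
    by (simp add: g_def root_reflection_def[of a] p_def)
  also have "p (root_reflection b x) = p x - M * q x" unfolding b p_shift by simp
  finally show ?thesis unfolding b by (simp add: algebra_simps)
qed

text \<open>\<open>g\<close> displaces \<open>x\<close> only within the plane of \<open>a\<close>
  and \<open>b\<close>, so powers of \<open>g\<close> are computed by updating the coefficients
  \<open>A\<close> and \<open>B\<close>.\<close>

lemma g_shift:
  "g (x + A *\<^sub>R a + B *\<^sub>R b) = x + (L * M * A - A + M * B + M * q x - p x) *\<^sub>R a + (- B - L * A - q x) *\<^sub>R b"
  unfolding g_eq[of "x + A *\<^sub>R a + B *\<^sub>R b"] p_shift q_shift by (simp add: algebra_simps flip: scaleR_2)

lemma g2_eq:
  "(g ^^ 2) x = x + (L * M * (M * q x - p x) - M * q x) *\<^sub>R a + (L * p x - L * M * q x) *\<^sub>R b"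
proof -
  have "(g ^^ 2) x = g (x + (M * q x - p x) *\<^sub>R a + (- q x) *\<^sub>R b)"
    using g_eq[of x] by (simp add: numeral_2_eq_2)
  then show ?thesis unfolding g_shift by (simp add: algebra_simps)
qed

lemma g3_eq:
  "(g ^^ 3) x = x + (L * M * (L * M - 1) * (M * q x - p x) - 2 * L * M * M * q x + 2 * M * q x + L * M * p x - p x) *\<^sub>R a
     + (- L * p x + 2 * L * M * q x - L * (L * M * (M * q x - p x)) - q x) *\<^sub>R b"
proof -
  have "(g ^^ 3) x = g ((g ^^ 2) x)" by (simp add: numeral_3_eq_3 numeral_2_eq_2)
  then show ?thesis unfolding g2_eq g_shift by (simp add: algebra_simps)
qed

lemma combination_eq_0:
  assumes "A *\<^sub>R a + B *\<^sub>R b = 0" shows "A = 0" "B = 0"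
proof -
  show B: "B = 0"
  proof (rule ccontr)
    assume "B \<noteq> 0"
    have "B *\<^sub>R b = (- A) *\<^sub>R a" using assms by (simp add: eq_neg_iff_add_eq_0 add.commute)
    then have "(1 / B) *\<^sub>R (B *\<^sub>R b) = (1 / B) *\<^sub>R ((- A) *\<^sub>R a)" by simp
    then have "b = (- A / B) *\<^sub>R a" using \<open>B \<noteq> 0\<close> by simp
    then show False using not_parallel by blast
  qed
  show "A = 0" using assms nonzero B by simp
qed

lemma bij_g: "bij g"
proof -
  have "g = root_reflection a \<circ> root_reflection b" by (auto simp: g_def)
  then show ?thesis using bij_comp bij_root_reflection by metis
qed

lemma order_dvd_iff:
  "group.ord (BijGroup UNIV) (root_reflection a \<otimes>\<^bsub>BijGroup UNIV\<^esub> root_reflection b) dvd n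
     \<longleftrightarrow> (\<forall>x. (g ^^ n) x = x)"
proof -
  interpret G: group "BijGroup (UNIV :: 'a set)" by (rule group_BijGroup)
  have eq: "root_reflection a \<otimes>\<^bsub>BijGroup UNIV\<^esub> root_reflection b = g"
    by (auto simp: mult_BijGroup_UNIV bij_root_reflection g_def)
  have "g \<in> carrier (BijGroup UNIV)" using bij_g by (simp add: carrier_BijGroup_UNIV)
  from G.pow_eq_id[OF this, of n] show ?thesis
    unfolding eq by (auto simp: pow_BijGroup_UNIV bij_g one_BijGroup_UNIV)
qed

lemma order_orthogonal:
  assumes "L * M = 0"
  shows "group.ord (BijGroup UNIV) (root_reflection a \<otimes>\<^bsub>BijGroup UNIV\<^esub> root_reflection b) \<le> 2"
proof -
  have "a \<bullet> b = 0" using assms nonzero by (simp add: L M)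
  then have "(g ^^ 2) x = x" for x unfolding g2_eq by (simp add: L M)
  then show ?thesis using order_dvd_iff[of 2] by (intro dvd_imp_le) auto
qed

text \<open>The vector \<open>b\<close> is a sufficient test: its displacement has the
  \<open>b\<close>-coefficient -2. The exponents 2 and 3 are refuted by the same vector.\<close>

lemma not_order_dvd_1:
  "\<not> group.ord (BijGroup UNIV) (root_reflection a \<otimes>\<^bsub>BijGroup UNIV\<^esub> root_reflection b) dvd 1"
proof
  assume "group.ord (BijGroup UNIV) (root_reflection a \<otimes>\<^bsub>BijGroup UNIV\<^esub> root_reflection b) dvd 1"
  then have "g b = b" using order_dvd_iff[of 1] by simp
  then have "(M * q b - p b) *\<^sub>R a + (- q b) *\<^sub>R b = 0" unfolding g_eq by (simp add: add.assoc)
  from combination_eq_0(2)[OF this] show False by (simp add: p_q_right)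
qed

lemma not_order_dvd_2:
  assumes "L * M \<noteq> 0"
  shows "\<not> group.ord (BijGroup UNIV) (root_reflection a \<otimes>\<^bsub>BijGroup UNIV\<^esub> root_reflection b) dvd 2"
proof
  assume "group.ord (BijGroup UNIV) (root_reflection a \<otimes>\<^bsub>BijGroup UNIV\<^esub> root_reflection b) dvd 2"
  then have "(g ^^ 2) b = b" using order_dvd_iff[of 2] by blast
  then have "(L * M * (M * q b - p b) - M * q b) *\<^sub>R a + (L * p b - L * M * q b) *\<^sub>R b = 0"
    unfolding g2_eq by (simp add: add.assoc)
  from combination_eq_0(2)[OF this] show False using assms by (simp add: p_q_right)
qed

lemma not_order_dvd_3:
  assumes "L * M = 3"
  shows "\<not> group.ord (BijGroup UNIV) (root_reflection a \<otimes>\<^bsub>BijGroup UNIV\<^esub> root_reflection b) dvd 3"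
proof
  assume "group.ord (BijGroup UNIV) (root_reflection a \<otimes>\<^bsub>BijGroup UNIV\<^esub> root_reflection b) dvd 3"
  then have "(g ^^ 3) b = b" using order_dvd_iff[of 3] by blast
  then have "(L * M * (L * M - 1) * (M * q b - p b) - 2 * L * M * M * q b + 2 * M * q b + L * M * p b - p b) *\<^sub>R a
     + (- L * p b + 2 * L * M * q b - L * (L * M * (M * q b - p b)) - q b) *\<^sub>R b = 0"
    unfolding g3_eq by (simp add: add.assoc)
  from combination_eq_0(2)[OF this]
  have "- (L * M) + 4 * (L * M) - (L * M) * (L * M) - 2 = 0" by (simp add: p_q_right algebra_simps)
  then show False unfolding assms by simp
qed

lemma order_eq_3:
  assumes "L * M = 1"
  shows "group.ord (BijGroup UNIV) (root_reflection a \<otimes>\<^bsub>BijGroup UNIV\<^esub> root_reflection b) = 3"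
proof -
  have LM: "L * (M * r) = r" for r using assms by (simp flip: mult.assoc)
  have "(g ^^ 3) x = x" for x
    unfolding g3_eq by (simp add: LM assms algebra_simps)
  then have "group.ord (BijGroup UNIV) (root_reflection a \<otimes>\<^bsub>BijGroup UNIV\<^esub> root_reflection b) dvd 3"
    using order_dvd_iff by blast
  moreover have "prime (3 :: nat)" by simp
  ultimately show ?thesis using not_order_dvd_1 by (metis dvd_refl prime_nat_iff)
qed

text \<open>For product 2 the square of \<open>g\<close> negates the pairings \<open>p\<close> and
  \<open>q\<close>, so squaring it again gives the identity.\<close>

lemma order_eq_4:
  assumes "L * M = 2"
  shows "group.ord (BijGroup UNIV) (root_reflection a \<otimes>\<^bsub>BijGroup UNIV\<^esub> root_reflection b) = 4"
    (is "?o = 4")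
proof -
  have LM: "L * (M * r) = 2 * r" for r using assms by (simp flip: mult.assoc)
  have g2: "(g ^^ 2) x = x + (M * q x - 2 * p x) *\<^sub>R a + (L * p x - 2 * q x) *\<^sub>R b" for x
    unfolding g2_eq by (simp add: LM assms algebra_simps)
  have pq: "p ((g ^^ 2) x) = - p x" "q ((g ^^ 2) x) = - q x" for x
    unfolding g2 p_shift q_shift by (simp_all add: LM assms algebra_simps)
  have "(g ^^ 4) x = x" for x
  proof -
    have "(g ^^ 4) x = (g ^^ 2) ((g ^^ 2) x)"
      using funpow_add[of 2 2 g] by (simp add: fun_eq_iff)
    then show ?thesis unfolding g2[of "(g ^^ 2) x"] pq by (simp add: g2 algebra_simps)
  qed
  then have "?o dvd 4" using order_dvd_iff by blast
  then have "?o \<le> 4" "?o \<noteq> 0" "?o \<noteq> 3" by (auto dest: dvd_imp_le intro!: Nat.gr0I)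
  moreover have "?o \<noteq> 1" "?o \<noteq> 2" using not_order_dvd_2 assms by auto
  ultimately show ?thesis by linarith
qed

text \<open>Here the cube of \<open>g\<close> negates \<open>p\<close> and \<open>q\<close>. Unlike
  for order 4, the divisor 3 has to be excluded as well.\<close>

lemma order_eq_6:
  assumes "L * M = 3"
  shows "group.ord (BijGroup UNIV) (root_reflection a \<otimes>\<^bsub>BijGroup UNIV\<^esub> root_reflection b) = 6"
    (is "?o = 6")
proof -
  have LM: "L * (M * r) = 3 * r" for r using assms by (simp flip: mult.assoc)
  have g3: "(g ^^ 3) x = x + (2 * M * q x - 4 * p x) *\<^sub>R a + (2 * L * p x - 4 * q x) *\<^sub>R b" for x
    unfolding g3_eq by (simp add: LM assms algebra_simps)
  have pq: "p ((g ^^ 3) x) = - p x" "q ((g ^^ 3) x) = - q x" for x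
    unfolding g3 p_shift q_shift by (simp_all add: LM assms algebra_simps)
  have "(g ^^ 6) x = x" for x
  proof -
    have "(g ^^ 6) x = (g ^^ 3) ((g ^^ 3) x)"
      using funpow_add[of 3 3 g] by (simp add: fun_eq_iff)
    then show ?thesis unfolding g3[of "(g ^^ 3) x"] pq by (simp add: g3 algebra_simps)
  qed
  then have "?o dvd 6" using order_dvd_iff by blast
  then have "?o \<le> 6" "?o \<noteq> 0" "?o \<noteq> 4" "?o \<noteq> 5" by (auto dest: dvd_imp_le intro!: Nat.gr0I)
  moreover have "?o \<noteq> 1" "?o \<noteq> 2" "?o \<noteq> 3"
    using not_order_dvd_2 not_order_dvd_3 assms by auto
  ultimately show ?thesis by linarith
qed

text \<open>The part \<open>v\<close> of \<open>b\<close> orthogonal to \<open>a\<close> is nonzero,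
  which makes Cauchy-Schwarz strict and the integer \<open>L * M\<close> less than 4.\<close>

lemma cartan_product_cases:
  assumes "L \<in> \<int>" "M \<in> \<int>" shows "L * M \<in> {0, 1, 2, 3}"
proof -
  define v where "v = b - ((a \<bullet> b) / (a \<bullet> a)) *\<^sub>R a"
  have a: "0 < a \<bullet> a" and b: "0 < b \<bullet> b" using nonzero by simp_all
  have "v \<noteq> 0" using not_parallel by (simp add: v_def)
  then have "0 < v \<bullet> v" by simp
  also have "v \<bullet> v = b \<bullet> b - (a \<bullet> b) * (a \<bullet> b) / (a \<bullet> a)"
    using a by (simp add: v_def inner_diff_left inner_diff_right inner_commute field_simps)
  finally have lt: "(a \<bullet> b) * (a \<bullet> b) < (a \<bullet> a) * (b \<bullet> b)" using a by (simp add: field_simps)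
  have LM: "L * M = 4 * ((a \<bullet> b) * (a \<bullet> b) / ((a \<bullet> a) * (b \<bullet> b)))" by (simp add: L M)
  have "(a \<bullet> b) * (a \<bullet> b) / ((a \<bullet> a) * (b \<bullet> b)) < 1" using lt a b by simp
  then have "L * M < 4" unfolding LM by simp
  moreover have "0 \<le> L * M" unfolding LM using a b by simp
  moreover obtain n where n: "L * M = of_int n" using assms by (metis Ints_cases Ints_mult)
  ultimately have "0 \<le> n" "n < 4" by simp_all
  then have "n = 0 \<or> n = 1 \<or> n = 2 \<or> n = 3" by linarith
  then show ?thesis using n by auto
qed

end

section \<open>The simple system of a chamber\<close>

text \<open>A cone-generating set of positive roots of least cardinality is cone-minimal, since a
  redundant root could be dropped.\<close>

lemma root_base_exists:
  fixes \<Psi> :: "'a::euclidean_space set"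
  assumes "finite \<Psi>"
    and "\<And>\<beta> r. \<beta> \<in> \<Psi> \<Longrightarrow> r *\<^sub>R \<beta> \<in> \<Psi> \<Longrightarrow> r = 1 \<or> r = -1"
    and "\<And>\<beta> \<gamma>. \<beta> \<in> \<Psi> \<Longrightarrow> \<gamma> \<in> \<Psi> \<Longrightarrow> root_reflection \<beta> \<gamma> \<in> \<Psi>"
    and "\<And>\<beta>. \<beta> \<in> \<Psi> \<Longrightarrow> c \<bullet> \<beta> \<noteq> 0"
    and "\<And>x. finite (orbit \<Psi> x)"
  obtains \<Delta> where "root_base \<Psi> \<Delta> c"
proof -
  define pos where "pos = {\<beta>\<in>\<Psi>. 0 < c \<bullet> \<beta>}"
  define good where "good S \<longleftrightarrow> S \<subseteq> pos \<and> pos \<subseteq> nonneg_span S" for S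
  have finpos: "finite pos" using assms(1) by (simp add: pos_def)
  have "good pos" using finpos by (auto simp: good_def intro: nonneg_span_base)
  then obtain S where S: "good S" and min: "\<And>T. good T \<Longrightarrow> card S \<le> card T"
    using ex_has_least_nat[of good pos card] by metis
  have fin: "finite S" using S finpos finite_subset by (auto simp: good_def)
  have "\<delta> \<notin> nonneg_span (S - {\<delta>})" if "\<delta> \<in> S" for \<delta>
  proof
    assume *: "\<delta> \<in> nonneg_span (S - {\<delta>})"
    have "S \<subseteq> nonneg_span (S - {\<delta>})"
    proof
      fix \<gamma> assume "\<gamma> \<in> S"
      then show "\<gamma> \<in> nonneg_span (S - {\<delta>})"
        using * fin by (cases "\<gamma> = \<delta>") (auto intro: nonneg_span_base)
    qed
    then have "nonneg_span S \<subseteq> nonneg_span (S - {\<delta>})" by (rule nonneg_span_subset)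
    then have "good (S - {\<delta>})" using S unfolding good_def by blast
    from min[OF this] show False using that fin by (metis card_Diff1_less not_le)
  qed
  then have "root_base \<Psi> S c"
    using assms S by unfold_locales (auto simp: good_def pos_def)
  with that show ?thesis .
qed

declare One_nat_def [simp del]

locale weyl_data =
  fixes \<Phi> D :: "'a::euclidean_space set" and d :: nat and \<alpha> \<omega> :: "nat \<Rightarrow> 'a"
  assumes root_system: "root_system \<Phi>" and crystallographic: "crystallographic \<Phi>"
    and d: "d = DIM('a)" and chamber: "chamber \<Phi> D"
    and enumeration: "simple_root_enumeration \<Phi> D d \<alpha>"
    and weights: "fundamental_weights d \<alpha> \<omega>"
begin

lemma finite_\<Phi>: "finite \<Phi>" and zero_notin_\<Phi>: "0 \<notin> \<Phi>" and span_\<Phi>: "span \<Phi> = UNIV"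
  and reduced_\<Phi>: "\<beta> \<in> \<Phi> \<Longrightarrow> r *\<^sub>R \<beta> \<in> \<Phi> \<Longrightarrow> r = 1 \<or> r = -1"
  and reflect_\<Phi>: "\<beta> \<in> \<Phi> \<Longrightarrow> \<gamma> \<in> \<Phi> \<Longrightarrow> root_reflection \<beta> \<gamma> \<in> \<Phi>"
  using root_system unfolding root_system_def by blast+

lemma uminus_\<Phi>: "\<beta> \<in> \<Phi> \<Longrightarrow> - \<beta> \<in> \<Phi>"
  by (metis reflect_\<Phi> root_reflection_self zero_notin_\<Phi>)

lemma simple_image: "simple_roots \<Phi> D = \<alpha> ` {1..d}" and inj_simple: "inj_on \<alpha> {1..d}"
  using enumeration unfolding simple_root_enumeration_def bij_betw_def by auto

lemma simple_in_\<Phi>: "i \<in> {1..d} \<Longrightarrow> \<alpha> i \<in> \<Phi>"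
  using simple_image unfolding simple_roots_def by blast

lemma simple_nonzero: "i \<in> {1..d} \<Longrightarrow> \<alpha> i \<noteq> 0"
  using simple_in_\<Phi> zero_notin_\<Phi> by metis

lemma simple_norm_pos: "i \<in> {1..d} \<Longrightarrow> 0 < \<alpha> i \<bullet> \<alpha> i"
  using simple_nonzero by simp

lemma weight_inner_coroot:
  "i \<in> {1..d} \<Longrightarrow> j \<in> {1..d} \<Longrightarrow> \<omega> i \<bullet> coroot (\<alpha> j) = (if i = j then 1 else 0)"
  using weights unfolding fundamental_weights_def by blast

lemma weight_inner_simple:
  assumes "i \<in> {1..d}" "j \<in> {1..d}" shows "\<omega> i \<bullet> \<alpha> j = (if i = j then \<alpha> j \<bullet> \<alpha> j / 2 else 0)"
  using weight_inner_coroot[OF assms] simple_norm_pos[OF assms(2)]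
  by (simp add: coroot_def field_simps split: if_splits)

text \<open>Pairing with the weights isolates each coefficient, so the simple roots are independent,
  and there are as many as the dimension.\<close>

lemma span_simple: "span (\<alpha> ` {1..d}) = UNIV"
proof -
  have "independent (\<alpha> ` {1..d})"
  proof (rule independent_if_scalars_zero)
    fix f v assume sum0: "(\<Sum>x\<in>\<alpha> ` {1..d}. f x *\<^sub>R x) = 0" and "v \<in> \<alpha> ` {1..d}"
    then obtain i where i: "i \<in> {1..d}" "v = \<alpha> i" by blast
    have "(\<Sum>j\<in>{1..d}. f (\<alpha> j) *\<^sub>R \<alpha> j) = 0"
      using sum0 unfolding sum.reindex[OF inj_simple] by simp
    then have "0 = \<omega> i \<bullet> (\<Sum>j\<in>{1..d}. f (\<alpha> j) *\<^sub>R \<alpha> j)" by simp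
    also have "\<dots> = (\<Sum>j\<in>{1..d}. if i = j then f (\<alpha> j) * (\<alpha> j \<bullet> \<alpha> j / 2) else 0)"
      unfolding inner_sum_right by (rule sum.cong) (use i weight_inner_simple in auto)
    also have "\<dots> = f (\<alpha> i) * (\<alpha> i \<bullet> \<alpha> i / 2)" using i by simp
    finally show "f v = 0" using simple_nonzero i by simp
  qed simp
  moreover have "card (\<alpha> ` {1..d}) = dim (UNIV :: 'a set)"
    using card_image[OF inj_simple] by (simp add: d)
  ultimately show ?thesis
    using card_eq_dim[of "\<alpha> ` {1..d}" UNIV] by auto
qed

lemma eq_0_if_orthogonal_simple:
  assumes "\<And>j. j \<in> {1..d} \<Longrightarrow> x \<bullet> \<alpha> j = 0" shows "x = 0"
proof -
  have "inner x v = 0" if "v \<in> span (\<alpha> ` {1..d})" for v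
    by (rule linear_eq_0_on_span[OF _ _ that]) (use assms in \<open>auto simp: bounded_linear.linear bounded_linear_inner_right\<close>)
  then show ?thesis using span_simple by (metis UNIV_I inner_eq_zero_iff)
qed

lemma weight_expansion: "x = (\<Sum>j\<in>{1..d}. (x \<bullet> coroot (\<alpha> j)) *\<^sub>R \<omega> j)"
proof -
  have "(x - (\<Sum>j\<in>{1..d}. (x \<bullet> coroot (\<alpha> j)) *\<^sub>R \<omega> j)) \<bullet> \<alpha> i = 0" if i: "i \<in> {1..d}" for i
  proof -
    have "(\<Sum>j\<in>{1..d}. (x \<bullet> coroot (\<alpha> j)) *\<^sub>R \<omega> j) \<bullet> \<alpha> i
        = (\<Sum>j\<in>{1..d}. if i = j then (x \<bullet> coroot (\<alpha> j)) * (\<alpha> j \<bullet> \<alpha> j / 2) else 0)"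
      unfolding inner_sum_left by (rule sum.cong) (use i weight_inner_simple in auto)
    also have "\<dots> = (x \<bullet> coroot (\<alpha> i)) * (\<alpha> i \<bullet> \<alpha> i / 2)" using i by (simp add: sum.delta)
    also have "\<dots> = x \<bullet> \<alpha> i" using simple_nonzero[OF i] by (simp add: coroot_def)
    finally show ?thesis by (simp add: inner_diff_left)
  qed
  then show ?thesis using eq_0_if_orthogonal_simple by fastforce
qed

lemma eq_0_if_orthogonal_weights:
  assumes "\<And>j. j \<in> {1..d} \<Longrightarrow> x \<bullet> \<omega> j = 0" shows "x = 0"
proof -
  have "x \<bullet> x = x \<bullet> (\<Sum>j\<in>{1..d}. (x \<bullet> coroot (\<alpha> j)) *\<^sub>R \<omega> j)"
    using weight_expansion[of x] by simp
  also have "\<dots> = 0" by (simp add: inner_sum_right assms)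
  finally show ?thesis by simp
qed

lemma coroot_expansion: "x = (\<Sum>j\<in>{1..d}. (x \<bullet> \<omega> j) *\<^sub>R coroot (\<alpha> j))"
proof -
  have "(x - (\<Sum>j\<in>{1..d}. (x \<bullet> \<omega> j) *\<^sub>R coroot (\<alpha> j))) \<bullet> \<omega> i = 0" if i: "i \<in> {1..d}" for i
  proof -
    have "(\<Sum>j\<in>{1..d}. (x \<bullet> \<omega> j) *\<^sub>R coroot (\<alpha> j)) \<bullet> \<omega> i = (\<Sum>j\<in>{1..d}. if i = j then x \<bullet> \<omega> j else 0)"
      unfolding inner_sum_left
      by (rule sum.cong) (use i weight_inner_coroot in \<open>auto simp: inner_commute\<close>)
    also have "\<dots> = x \<bullet> \<omega> i" using i by (simp add: sum.delta)
    finally show ?thesis by (simp add: inner_diff_left)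
  qed
  then show ?thesis using eq_0_if_orthogonal_weights by fastforce
qed

lemma weight_in_chamber: "i \<in> {1..d} \<Longrightarrow> \<omega> i \<in> D"
  by (rule chamber_simple_halfspaces[OF finite_\<Phi> uminus_\<Phi> chamber])
    (auto simp: simple_image weight_inner_simple)

text \<open>All weights lie in the chamber, which lies on one side of every root hyperplane.\<close>

lemma root_sign:
  assumes "\<beta> \<in> \<Phi>"
  shows "(\<forall>i\<in>{1..d}. 0 \<le> \<omega> i \<bullet> \<beta>) \<or> (\<forall>i\<in>{1..d}. \<omega> i \<bullet> \<beta> \<le> 0)"
proof -
  obtain x0 where "\<And>\<beta>. \<beta> \<in> \<Phi> \<Longrightarrow> x0 \<bullet> \<beta> \<noteq> 0" "D = {x. \<forall>\<beta>\<in>\<Phi>. 0 \<le> (x0 \<bullet> \<beta>) * (x \<bullet> \<beta>)}"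
    using chamber_sign_cone[OF finite_\<Phi> chamber] by metis
  then have "x0 \<bullet> \<beta> \<noteq> 0" "\<And>i. i \<in> {1..d} \<Longrightarrow> 0 \<le> (x0 \<bullet> \<beta>) * (\<omega> i \<bullet> \<beta>)"
    using weight_in_chamber assms by auto
  then show ?thesis by (cases "0 < x0 \<bullet> \<beta>") (auto simp: zero_le_mult_iff)
qed

text \<open>The Weyl vector, used as the regular vector both for \<open>\<Phi>\<close> and for the
  subsystem in \<open>labelled_edge_decomposable\<close>.\<close>

definition \<rho> :: 'a where "\<rho> = (\<Sum>i\<in>{1..d}. \<omega> i)"

lemma \<rho>_regular: assumes "\<beta> \<in> \<Phi>" shows "\<rho> \<bullet> \<beta> \<noteq> 0"
proof
  assume "\<rho> \<bullet> \<beta> = 0"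
  then have 0: "(\<Sum>i\<in>{1..d}. \<omega> i \<bullet> \<beta>) = 0" by (simp add: \<rho>_def inner_sum_left)
  have "\<forall>i\<in>{1..d}. \<omega> i \<bullet> \<beta> = 0"
    using root_sign[OF assms]
  proof
    assume "\<forall>i\<in>{1..d}. 0 \<le> \<omega> i \<bullet> \<beta>"
    then show ?thesis using 0 sum_nonneg_eq_0_iff[of "{1..d}" "\<lambda>i. \<omega> i \<bullet> \<beta>"] by simp
  next
    assume "\<forall>i\<in>{1..d}. \<omega> i \<bullet> \<beta> \<le> 0"
    then show ?thesis
      using 0 sum_nonneg_eq_0_iff[of "{1..d}" "\<lambda>i. - (\<omega> i \<bullet> \<beta>)"] by (simp add: sum_negf)
  qed
  then have "\<beta> = 0" by (intro eq_0_if_orthogonal_weights) (simp add: inner_commute)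
  then show False using assms zero_notin_\<Phi> by blast
qed

lemma pos_root_weights:
  assumes "\<beta> \<in> \<Phi>" "0 < \<rho> \<bullet> \<beta>" "i \<in> {1..d}" shows "0 \<le> \<omega> i \<bullet> \<beta>"
proof -
  have "\<not> (\<forall>i\<in>{1..d}. \<omega> i \<bullet> \<beta> \<le> 0)"
    using assms(2) sum_nonpos[of "{1..d}" "\<lambda>i. \<omega> i \<bullet> \<beta>"] by (force simp: \<rho>_def inner_sum_left)
  then show ?thesis using root_sign[OF assms(1)] assms(3) by blast
qed

lemma finite_orbit_\<Phi>: "finite (orbit \<Phi> x)"
  using finite_orbit_spanning[OF finite_\<Phi> span_\<Phi>] reflect_\<Phi> by blast

lemma \<rho>_simple: "i \<in> {1..d} \<Longrightarrow> 0 < \<rho> \<bullet> \<alpha> i"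
  using simple_norm_pos[of i] by (simp add: \<rho>_def inner_sum_left weight_inner_simple sum.delta')

text \<open>The coroot coordinates of a positive root are its pairings with the weights, hence
  nonnegative. Minimality is witnessed by \<open>- \<omega> i\<close>, which is negative on
  \<open>\<alpha> i\<close> and 0 on the other simple roots.\<close>

sublocale base: root_base \<Phi> "\<alpha> ` {1..d}" \<rho>
proof
  fix \<beta> assume \<beta>: "\<beta> \<in> \<Phi>" "0 < \<rho> \<bullet> \<beta>"
  have "(\<Sum>j\<in>{1..d}. (\<beta> \<bullet> \<omega> j) *\<^sub>R coroot (\<alpha> j)) \<in> nonneg_span (\<alpha> ` {1..d})"
  proof (rule nonneg_span_sum)
    fix j assume j: "j \<in> {1..d}"
    have "(\<beta> \<bullet> \<omega> j) *\<^sub>R coroot (\<alpha> j) = (2 * (\<beta> \<bullet> \<omega> j) / (\<alpha> j \<bullet> \<alpha> j)) *\<^sub>R \<alpha> j"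
      by (simp add: coroot_def)
    also have "\<dots> \<in> nonneg_span (\<alpha> ` {1..d})"
      using pos_root_weights[OF \<beta> j] simple_norm_pos[OF j] j
      by (intro nonneg_span_scaleR nonneg_span_base) (auto simp: inner_commute)
    finally show "(\<beta> \<bullet> \<omega> j) *\<^sub>R coroot (\<alpha> j) \<in> nonneg_span (\<alpha> ` {1..d})" .
  qed
  then show "\<beta> \<in> nonneg_span (\<alpha> ` {1..d})" using coroot_expansion[of \<beta>] by simp
next
  fix \<delta> assume "\<delta> \<in> \<alpha> ` {1..d}"
  then obtain i where i: "i \<in> {1..d}" "\<delta> = \<alpha> i" by blast
  show "\<delta> \<notin> nonneg_span (\<alpha> ` {1..d} - {\<delta>})"
  proof
    assume "\<delta> \<in> nonneg_span (\<alpha> ` {1..d} - {\<delta>})"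
    then have "0 \<le> (- \<omega> i) \<bullet> \<delta>"
      by (rule nonneg_span_inner_nonneg) (use i weight_inner_simple in auto)
    then have "\<alpha> i \<bullet> \<alpha> i \<le> 0" using i by (simp add: weight_inner_simple)
    then show False using simple_norm_pos[OF i(1)] by linarith
  qed
qed (use finite_\<Phi> reduced_\<Phi> reflect_\<Phi> \<rho>_regular finite_orbit_\<Phi> simple_in_\<Phi> \<rho>_simple in auto)

lemma weight_dominant: "i \<in> {1..d} \<Longrightarrow> 0 \<le> k \<Longrightarrow> base.dominant (k *\<^sub>R \<omega> i)"
  by (auto simp: base.dominant_def weight_inner_simple)

section \<open>Cartan integers and the Dynkin diagram\<close>

text \<open>The Cartan integer, normalised by the second root: the coroot is that of
  \<open>\<alpha> j\<close>.\<close>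

definition cartan :: "nat \<Rightarrow> nat \<Rightarrow> real" where
  "cartan i j = 2 * (\<alpha> i \<bullet> \<alpha> j) / (\<alpha> j \<bullet> \<alpha> j)"

lemma simple_not_parallel:
  assumes "i \<in> {1..d}" "j \<in> {1..d}" "i \<noteq> j" shows "\<alpha> j \<noteq> r *\<^sub>R \<alpha> i"
proof
  assume "\<alpha> j = r *\<^sub>R \<alpha> i"
  then have "\<omega> j \<bullet> \<alpha> j = r * (\<omega> j \<bullet> \<alpha> i)" by simp
  then show False using assms simple_nonzero by (simp add: weight_inner_simple)
qed

lemma root_pair_simple:
  assumes "i \<in> {1..d}" "j \<in> {1..d}" "i \<noteq> j"
  shows "root_pair (\<alpha> i) (\<alpha> j) (cartan i j) (cartan j i)"
  using assms simple_nonzero simple_not_parallel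
  by unfold_locales (auto simp: cartan_def inner_commute)

lemma cartan_Ints: "i \<in> {1..d} \<Longrightarrow> j \<in> {1..d} \<Longrightarrow> cartan i j \<in> \<int>"
  using crystallographic simple_in_\<Phi> unfolding crystallographic_def cartan_def
  by (subst inner_commute[of "\<alpha> i" "\<alpha> j"]) blast

lemma simple_inner_nonpos: "i \<in> {1..d} \<Longrightarrow> j \<in> {1..d} \<Longrightarrow> i \<noteq> j \<Longrightarrow> \<alpha> i \<bullet> \<alpha> j \<le> 0"
  using base.simple_obtuse[of "\<alpha> j" "\<alpha> i"] simple_not_parallel[of i j 1] by auto

lemma simple_cartan_product:
  assumes "i \<in> {1..d}" "j \<in> {1..d}" "i \<noteq> j"
  shows "cartan i j * cartan j i \<in> {0, 1, 2, 3}"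
  using root_pair.cartan_product_cases[OF root_pair_simple[OF assms]] cartan_Ints assms by blast

lemma cartan_product_eq_0_iff:
  assumes "i \<in> {1..d}" "j \<in> {1..d}"
  shows "cartan i j * cartan j i = 0 \<longleftrightarrow> \<alpha> i \<bullet> \<alpha> j = 0"
  using assms simple_nonzero by (auto simp: cartan_def inner_commute)

text \<open>Integrality leaves the Cartan products 0, 1, 2, 3, for which the order is at most 2, or
  3, 4, 6 respectively.\<close>

lemma coxeter_order_gt_2_iff:
  assumes "i \<in> {1..d}" "j \<in> {1..d}" "i \<noteq> j"
  shows "coxeter_order \<alpha> i j > 2 \<longleftrightarrow> \<alpha> i \<bullet> \<alpha> j \<noteq> 0"
proof -
  interpret root_pair "\<alpha> i" "\<alpha> j" "cartan i j" "cartan j i" by (rule root_pair_simple[OF assms])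
  show ?thesis
    using simple_cartan_product[OF assms] order_orthogonal order_eq_3 order_eq_4 order_eq_6
      cartan_product_eq_0_iff[OF assms(1,2)]
    unfolding coxeter_order_def by fastforce
qed

lemma coxeter_order_eq_3_iff:
  assumes "i \<in> {1..d}" "j \<in> {1..d}" "i \<noteq> j"
  shows "coxeter_order \<alpha> i j = 3 \<longleftrightarrow> cartan i j * cartan j i = 1"
proof -
  interpret root_pair "\<alpha> i" "\<alpha> j" "cartan i j" "cartan j i" by (rule root_pair_simple[OF assms])
  show ?thesis
    using simple_cartan_product[OF assms] order_orthogonal order_eq_3 order_eq_4 order_eq_6
    unfolding coxeter_order_def by fastforce
qed

lemma dynkin_edge_iff:
  "dynkin_edge d \<alpha> i j \<longleftrightarrow> i \<in> {1..d} \<and> j \<in> {1..d} \<and> i \<noteq> j \<and> \<alpha> i \<bullet> \<alpha> j \<noteq> 0"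
  using coxeter_order_gt_2_iff unfolding dynkin_edge_def by blast

lemma incident_edges_unlabeled_iff:
  assumes "i \<in> {1..d}"
  shows "incident_edges_unlabeled d \<alpha> i \<longleftrightarrow>
    (\<forall>j\<in>{1..d}. j \<noteq> i \<longrightarrow> \<alpha> i \<bullet> \<alpha> j \<noteq> 0 \<longrightarrow> cartan i j * cartan j i = 1)"
  using assms coxeter_order_eq_3_iff
  by (auto simp: incident_edges_unlabeled_def dynkin_neighbors_def dynkin_edge_iff)

text \<open>The sum of the normalised vectors would have nonpositive square length.\<close>

lemma no_triangle:
  assumes "i \<in> {1..d}" "j \<in> {1..d}" "k \<in> {1..d}" "i \<noteq> j" "j \<noteq> k" "i \<noteq> k"
    and "\<alpha> i \<bullet> \<alpha> j \<noteq> 0" "\<alpha> j \<bullet> \<alpha> k \<noteq> 0"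
  shows "\<alpha> i \<bullet> \<alpha> k = 0"
proof (rule ccontr)
  assume "\<alpha> i \<bullet> \<alpha> k \<noteq> 0"
  \<comment> \<open>The cosine \<open>s\<close> satisfies \<open>4 * (s * s) \<ge> 1\<close>,
    because a nonzero Cartan product is at least 1, and \<open>s\<close> is nonpositive by
    obtuseness.\<close>
  have half: "sgn (\<alpha> a) \<bullet> sgn (\<alpha> b) \<le> - (1 / 2)"
    if "a \<in> {1..d}" "b \<in> {1..d}" "a \<noteq> b" "\<alpha> a \<bullet> \<alpha> b \<noteq> 0" for a b
  proof -
    have pos: "0 < norm (\<alpha> a)" "0 < norm (\<alpha> b)" using simple_nonzero that by auto
    define s where "s = (\<alpha> a \<bullet> \<alpha> b) / (norm (\<alpha> a) * norm (\<alpha> b))"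
    have "1 \<le> cartan a b * cartan b a"
      using simple_cartan_product[OF that(1-3)] cartan_product_eq_0_iff[OF that(1,2)] that(4) by auto
    also have "\<dots> = 4 * (s * s)"
      by (simp add: cartan_def s_def inner_commute power2_norm_eq_inner[symmetric] power2_eq_square)
    finally have "(1 / 2)\<^sup>2 \<le> (- s)\<^sup>2" by (simp add: power2_eq_square)
    moreover have "s \<le> 0"
      using simple_inner_nonpos[OF that(1-3)] pos by (simp add: s_def divide_nonpos_pos)
    ultimately have "1 / 2 \<le> - s" using power2_le_imp_le[of "1/2" "- s"] by simp
    moreover have "sgn (\<alpha> a) \<bullet> sgn (\<alpha> b) = s"
      using pos by (simp add: sgn_div_norm s_def divide_simps)
    ultimately show ?thesis by simp
  qed
  define v where "v = sgn (\<alpha> i) + sgn (\<alpha> j) + sgn (\<alpha> k)"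
  have "sgn (\<alpha> a) \<bullet> sgn (\<alpha> a) = 1" if "a \<in> {1..d}" for a
    using simple_nonzero[OF that] by (simp add: norm_sgn flip: power2_norm_eq_inner)
  then have "v \<bullet> v \<le> 0"
    using half[of i j] half[of j k] half[of i k] assms \<open>\<alpha> i \<bullet> \<alpha> k \<noteq> 0\<close>
    by (simp add: v_def inner_add_left inner_add_right inner_commute)
  then have "v = 0" by (metis inner_eq_zero_iff inner_ge_zero order_antisym)
  \<comment> \<open>A positive combination of simple roots pairs positively with
    \<open>\<rho>\<close>, so \<open>v\<close> cannot be 0.\<close>
  moreover have "0 < \<rho> \<bullet> sgn (\<alpha> a)" if "a \<in> {1..d}" for a
    using \<rho>_simple[OF that] simple_nonzero[OF that] by (simp add: sgn_div_norm)
  then have "0 < \<rho> \<bullet> v"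
    using assms by (simp add: v_def inner_add_right add_pos_pos)
  ultimately show False by simp
qed

text \<open>An edge between two neighbours of \<open>i\<close> would close a triangle, so all edges
  of the neighbourhood are incident to \<open>i\<close>.\<close>

lemma simply_laced_neighborhood:
  assumes "i \<in> {1..d}"
  shows "incident_edges_unlabeled d \<alpha> i \<longleftrightarrow>
    simply_laced_on d \<alpha> (insert i (dynkin_neighbors d \<alpha> i))"
proof
  assume unl: "incident_edges_unlabeled d \<alpha> i"
  show "simply_laced_on d \<alpha> (insert i (dynkin_neighbors d \<alpha> i))"
    unfolding simply_laced_on_def
  proof (intro ballI impI)
    fix a b assume ab: "a \<in> insert i (dynkin_neighbors d \<alpha> i)"
      "b \<in> insert i (dynkin_neighbors d \<alpha> i)" "dynkin_edge d \<alpha> a b"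
    then have e: "a \<in> {1..d}" "b \<in> {1..d}" "a \<noteq> b" "\<alpha> a \<bullet> \<alpha> b \<noteq> 0"
      by (auto simp: dynkin_edge_iff)
    have "a = i \<or> b = i"
    proof (rule ccontr)
      assume "\<not> ?thesis"
      then show False
        using ab e no_triangle[of i a b] assms
        by (auto simp: dynkin_neighbors_def dynkin_edge_iff)
    qed
    then have "cartan a b * cartan b a = 1"
      using unl e unfolding incident_edges_unlabeled_iff[OF assms]
      by (auto simp: inner_commute mult.commute)
    then show "coxeter_order \<alpha> a b = 3" using coxeter_order_eq_3_iff e by blast
  qed
next
  assume "simply_laced_on d \<alpha> (insert i (dynkin_neighbors d \<alpha> i))"
  then show "incident_edges_unlabeled d \<alpha> i"
    by (auto simp: simply_laced_on_def incident_edges_unlabeled_def dynkin_neighbors_def)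
qed

end

section \<open>Indecomposable weight polytopes\<close>

context weyl_data
begin

lemma weight_multiple_eqI:
  assumes i: "i \<in> {1..d}" and "\<And>j. j \<in> {1..d} \<Longrightarrow> j \<noteq> i \<Longrightarrow> x \<bullet> \<alpha> j = 0"
  shows "x = (x \<bullet> coroot (\<alpha> i)) *\<^sub>R \<omega> i"
proof -
  have "(x - (x \<bullet> coroot (\<alpha> i)) *\<^sub>R \<omega> i) \<bullet> \<alpha> j = 0" if "j \<in> {1..d}" for j
    using assms that simple_nonzero[OF i]
    by (cases "j = i") (simp_all add: inner_diff_left weight_inner_simple coroot_def)
  then show ?thesis using eq_0_if_orthogonal_simple by fastforce
qed

text \<open>Given a second positive coordinate at \<open>j\<close>, the part along
  \<open>\<omega> i\<close> is split off; it vanishes on \<open>\<alpha> j\<close> but not on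
  \<open>\<alpha> i\<close>. The case \<open>x = 0\<close> drops out because a point is not
  indecomposable.\<close>

lemma indecomposable_dominant_multiple:
  assumes dom: "base.dominant x" and indec: "indecomposable (convex hull (orbit \<Phi> x))"
  obtains i k where "i \<in> {1..d}" "0 < k" "x = k *\<^sub>R \<omega> i"
proof -
  have nonneg: "0 \<le> x \<bullet> \<alpha> j" if "j \<in> {1..d}" for j
    using dom that by (auto simp: base.dominant_def)
  have "x \<noteq> 0"
  proof
    assume "x = 0"
    then have "orbit \<Phi> x = {0}"
      using orbit_scaleR[of \<Phi> 0 x] orbit_refl[of x \<Phi>] by auto
    then show False using indec unfolding indecomposable_def by auto
  qed
  then obtain i where i: "i \<in> {1..d}" "x \<bullet> \<alpha> i \<noteq> 0"
    using eq_0_if_orthogonal_simple by blast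
  define k where "k = x \<bullet> coroot (\<alpha> i)"
  have pos: "0 < x \<bullet> \<alpha> i" using i nonneg by force
  then have "0 < k" using simple_norm_pos[OF i(1)] by (simp add: k_def coroot_def)
  have k: "k * (\<alpha> i \<bullet> \<alpha> i / 2) = x \<bullet> \<alpha> i"
    using simple_nonzero[OF i(1)] by (simp add: k_def coroot_def)
  have "x \<bullet> \<alpha> j = 0" if j: "j \<in> {1..d}" "j \<noteq> i" for j
  proof (rule ccontr)
    assume "x \<bullet> \<alpha> j \<noteq> 0"
    then have xj: "0 < x \<bullet> \<alpha> j" using nonneg j by force
    have "base.dominant (x - k *\<^sub>R \<omega> i)"
      unfolding base.dominant_def
    proof
      fix \<delta> assume "\<delta> \<in> \<alpha> ` {1..d}"
      then obtain l where l: "l \<in> {1..d}" "\<delta> = \<alpha> l" by blast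
      show "0 \<le> (x - k *\<^sub>R \<omega> i) \<bullet> \<delta>"
        using nonneg[OF l(1)] k i l by (cases "l = i") (simp_all add: inner_diff_left weight_inner_simple)
    qed
    moreover have "(k *\<^sub>R \<omega> i) \<bullet> \<alpha> j = 0" "0 < (k *\<^sub>R \<omega> i) \<bullet> \<alpha> i"
      using i j k pos by (simp_all add: weight_inner_simple)
    ultimately show False
      using base.not_indecomposable_orbit[OF dom weight_dominant[OF i(1)], of k "\<alpha> j" "\<alpha> i"]
        \<open>0 < k\<close> xj i j indec by auto
  qed
  then have "x = k *\<^sub>R \<omega> i" unfolding k_def using weight_multiple_eqI i by blast
  with that i \<open>0 < k\<close> show ?thesis by blast
qed

lemma reflection_fixes_weight:
  assumes "i \<in> {1..d}" "j \<in> {1..d}" "j \<noteq> i"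
  shows "root_reflection (\<alpha> j) (k *\<^sub>R \<omega> i) = k *\<^sub>R \<omega> i"
  using assms by (intro root_reflection_eq_self) (simp add: weight_inner_simple)

text \<open>Two adjacent simple roots of different length: the roots of the length of \<open>\<alpha> i\<close> form a
  subsystem whose reflections already generate the orbit of \<open>\<omega> i\<close>, and in which both \<open>\<alpha> i\<close> and its
  image under the \<open>j\<close>-th reflection are simple. So \<open>\<omega> i\<close> is not a multiple of a fundamental weight
  of the subsystem.\<close>

lemma labelled_edge_decomposable:
  assumes i: "i \<in> {1..d}" and j: "j \<in> {1..d}" "j \<noteq> i" and "0 < k"
    and nonorth: "\<alpha> i \<bullet> \<alpha> j \<noteq> 0" and label: "cartan i j * cartan j i \<noteq> 1"
  shows "\<not> indecomposable (convex hull (orbit \<Phi> (k *\<^sub>R \<omega> i)))"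
proof -
  define x where "x = k *\<^sub>R \<omega> i"
  define \<Psi> where "\<Psi> = {\<beta>\<in>\<Phi>. norm \<beta> = norm (\<alpha> i)}"
  have norm_reflect: "norm (root_reflection \<beta> v) = norm v" for \<beta> v :: 'a
    by (simp add: norm_eq_sqrt_inner inner_root_reflection)
  \<comment> \<open>Equal lengths would make the two Cartan integers equal and their product a
    square, but the label leaves only 2 or 3.\<close>
  have "\<alpha> j \<notin> \<Psi>"
  proof
    assume "\<alpha> j \<in> \<Psi>"
    then have "\<alpha> i \<bullet> \<alpha> i = \<alpha> j \<bullet> \<alpha> j" by (simp add: \<Psi>_def norm_eq)
    then have "cartan i j = cartan j i" by (simp add: cartan_def inner_commute)
    moreover obtain n where n: "cartan i j = of_int n"
      using cartan_Ints[OF i j(1)] by (auto elim: Ints_cases)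
    ultimately have "real_of_int (n * n) \<in> {2, 3}"
      using simple_cartan_product[OF i j(1)] cartan_product_eq_0_iff[OF i j(1)] j(2) nonorth label
      by auto
    then have "n * n = 2 \<or> n * n = 3"
      by (simp only: insert_iff empty_iff of_int_eq_numeral_iff simp_thms)
    then have "2 \<le> \<bar>n\<bar> * \<bar>n\<bar>" "\<bar>n\<bar> * \<bar>n\<bar> \<le> 3" by (auto simp: abs_mult_self_eq)
    moreover have "\<bar>n\<bar> \<le> 1 \<or> 2 \<le> \<bar>n\<bar>" by linarith
    moreover have "2 \<le> \<bar>n\<bar> \<Longrightarrow> 2 * 2 \<le> \<bar>n\<bar> * \<bar>n\<bar>" by (rule mult_mono) auto
    moreover have "\<bar>n\<bar> \<le> 1 \<Longrightarrow> \<bar>n\<bar> * \<bar>n\<bar> \<le> 1 * 1" by (rule mult_mono) auto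
    ultimately show False by linarith
  qed
  have fin: "finite (orbit \<Psi> y)" for y
    using finite_subset[OF orbit_mono finite_orbit_\<Phi>, of \<Psi>] by (auto simp: \<Psi>_def)
  \<comment> \<open>Stability under all reflections of \<open>\<Phi>\<close> matters, since the
    reflection in \<open>\<alpha> j\<close> is not one of the subsystem.\<close>
  have reflect_\<Psi>: "root_reflection \<beta> \<gamma> \<in> \<Psi>" if "\<beta> \<in> \<Phi>" "\<gamma> \<in> \<Psi>" for \<beta> \<gamma>
    using that reflect_\<Phi> norm_reflect by (simp add: \<Psi>_def)
  obtain \<Delta> where base': "root_base \<Psi> \<Delta> \<rho>"
  proof (rule root_base_exists[of \<Psi> \<rho>])
    show "finite \<Psi>" using finite_\<Phi> by (simp add: \<Psi>_def)
    show "root_reflection \<beta> \<gamma> \<in> \<Psi>" if "\<beta> \<in> \<Psi>" "\<gamma> \<in> \<Psi>" for \<beta> \<gamma>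
      using that reflect_\<Psi> by (simp add: \<Psi>_def)
  qed (use reduced_\<Phi> \<rho>_regular fin in \<open>auto simp: \<Psi>_def\<close>)
  interpret B: root_base \<Psi> \<Delta> \<rho> by (rule base')
  have \<Delta>_\<Phi>: "\<delta> \<in> \<Phi>" "0 < \<rho> \<bullet> \<delta>" if "\<delta> \<in> \<Delta>" for \<delta>
    using B.simple_root[OF that] B.simple_pos[OF that] by (auto simp: \<Psi>_def)
  \<comment> \<open>\<open>\<Delta>\<close> consists of positive roots of \<open>\<Phi>\<close> as
    well, and its cone contains \<open>\<alpha> i\<close>, which is extreme already in the larger
    cone.\<close>
  have i\<Delta>: "\<alpha> i \<in> \<Delta>"
  proof (rule base.simple_in_generating_set)
    show "\<alpha> i \<in> nonneg_span \<Delta>"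
      using i simple_in_\<Phi> \<rho>_simple by (intro B.pos_root_nonneg_span) (auto simp: \<Psi>_def)
  qed (use i \<Delta>_\<Phi> in auto)
  define \<gamma> where "\<gamma> = root_reflection (\<alpha> j) (\<alpha> i)"
  have \<gamma>_pos: "\<gamma> \<in> \<Psi>" "0 < \<rho> \<bullet> \<gamma>"
    using reflect_\<Psi> simple_in_\<Phi> i j B.simple_root[OF i\<Delta>]
      base.simple_reflection_pos[of "\<alpha> j" "\<alpha> i"] \<rho>_simple simple_not_parallel[OF j(1) i j(2), of 1]
    by (auto simp: \<gamma>_def)
  have \<gamma>\<Delta>: "\<gamma> \<in> \<Delta>"
  proof -
    \<comment> \<open>The reflection in \<open>\<alpha> j\<close> makes only
      \<open>\<alpha> j\<close> negative among positive roots, and \<open>\<Delta>\<close> does not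
      contain it. So the reflected \<open>\<Delta>\<close> stays positive and must contain the
      extreme root \<open>\<alpha> i\<close>.\<close>
    have "\<alpha> i \<in> root_reflection (\<alpha> j) ` \<Delta>"
    proof (rule base.simple_in_generating_set)
      have "\<gamma> \<in> nonneg_span \<Delta>" using \<gamma>_pos B.pos_root_nonneg_span by blast
      from nonneg_span_linear_image[OF linear_root_reflection B.finite_simple this, of "\<alpha> j"]
      show "\<alpha> i \<in> nonneg_span (root_reflection (\<alpha> j) ` \<Delta>)" by (simp add: \<gamma>_def)
      show "root_reflection (\<alpha> j) ` \<Delta> \<subseteq> \<Phi>" using reflect_\<Phi> simple_in_\<Phi> j \<Delta>_\<Phi> by blast
      fix \<eta> assume "\<eta> \<in> root_reflection (\<alpha> j) ` \<Delta>"
      then obtain \<delta> where \<delta>: "\<delta> \<in> \<Delta>" "\<eta> = root_reflection (\<alpha> j) \<delta>" by blast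
      then have "\<delta> \<noteq> \<alpha> j" using B.simple_root \<open>\<alpha> j \<notin> \<Psi>\<close> by blast
      then show "0 < \<rho> \<bullet> \<eta>"
        using base.simple_reflection_pos[of "\<alpha> j" \<delta>] \<Delta>_\<Phi>[OF \<delta>(1)] \<delta> j by auto
    qed (use i in auto)
    then show ?thesis by (auto simp: \<gamma>_def)
  qed
  have "\<gamma> \<noteq> \<alpha> i" using nonorth simple_nonzero[OF j(1)] by (auto simp: \<gamma>_def root_reflection_def)
  have fix_x: "root_reflection (\<alpha> l) x = x" if "l \<in> {1..d}" "l \<noteq> i" for l
    unfolding x_def using reflection_fixes_weight i that by blast
  have x_i: "0 < x \<bullet> \<alpha> i" using i \<open>0 < k\<close> simple_norm_pos by (simp add: x_def weight_inner_simple)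
  have x_\<gamma>: "x \<bullet> \<gamma> = x \<bullet> \<alpha> i"
    using fix_x[OF j] by (simp add: \<gamma>_def flip: inner_root_reflection_commute)
  have "base.dominant x" unfolding x_def using weight_dominant i \<open>0 < k\<close> by simp
  then have domx: "B.dominant x"
    unfolding B.dominant_def using base.dominant_pos_root \<Delta>_\<Phi> by blast
  obtain y where y: "\<And>\<delta>. \<delta> \<in> \<Delta> \<Longrightarrow> y \<bullet> \<delta> = (if \<delta> = \<alpha> i then 0 else x \<bullet> \<delta>)"
    using B.simple_dual_vector[where g = "\<lambda>\<delta>. if \<delta> = \<alpha> i then 0 else x \<bullet> \<delta>"] by metis
  have "B.dominant y" "B.dominant (x - y)"
    using domx y by (auto simp: B.dominant_def inner_diff_left)
  then have not_indec: "\<not> indecomposable (convex hull (orbit \<Psi> x))"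
    using B.not_indecomposable_orbit[OF domx _ _ i\<Delta> x_i _ \<gamma>\<Delta>, of y] y i\<Delta> \<gamma>\<Delta> \<open>\<gamma> \<noteq> \<alpha> i\<close> x_i x_\<gamma> by auto
  have "orbit \<Phi> x \<subseteq> orbit \<Psi> x"
  proof
    fix z assume "z \<in> orbit \<Phi> x"
    then have "z \<in> orbit (\<alpha> ` {1..d}) x" by (simp add: base.orbit_simple)
    then show "z \<in> orbit \<Psi> x"
    proof (induction rule: orbit_induct)
      case (step z a)
      then obtain l where l: "l \<in> {1..d}" "a = \<alpha> l" by blast
      show ?case
      proof (cases "l = i")
        case True
        then show ?thesis using orbit_root_reflection[OF B.simple_root[OF i\<Delta>] step.IH] l by simp
      next
        case False
        obtain ws where ws: "set ws \<subseteq> \<Psi>" "z = reflect_word ws x"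
          using step.IH by (auto simp: orbit_def)
        have "root_reflection a z = reflect_word (map (root_reflection a) ws) x"
          using fix_x[OF l(1) False] by (simp add: ws(2) root_reflection_reflect_word l(2))
        moreover have "set (map (root_reflection a) ws) \<subseteq> \<Psi>"
          using ws(1) reflect_\<Psi> simple_in_\<Phi> l by auto
        ultimately show ?thesis using orbitI by metis
      qed
    qed (rule orbit_refl)
  qed
  moreover have "orbit \<Psi> x \<subseteq> orbit \<Phi> x" by (rule orbit_mono) (auto simp: \<Psi>_def)
  ultimately have "orbit \<Phi> x = orbit \<Psi> x" by (rule equalityI)
  then show ?thesis using not_indec by (simp add: x_def)
qed

text \<open>Two nonpositive integers with product 1 are both -1.\<close>

lemma unlabelled_cartan:
  assumes "i \<in> {1..d}" "j \<in> {1..d}" "j \<noteq> i" "cartan i j * cartan j i = 1"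
  shows "root_reflection (\<alpha> j) (\<alpha> i) = \<alpha> i + \<alpha> j" "root_reflection (\<alpha> i) (\<alpha> j) = \<alpha> i + \<alpha> j"
proof -
  obtain m n where mn: "cartan i j = of_int m" "cartan j i = of_int n"
    using cartan_Ints assms by (meson Ints_cases)
  have "cartan i j \<le> 0"
    using simple_inner_nonpos[OF assms(1,2)] assms(3) simple_norm_pos[OF assms(2)]
    by (auto simp: cartan_def divide_nonpos_pos)
  then have "m \<le> 0" using mn by simp
  moreover have "m * n = 1" using assms(4) mn by (metis of_int_eq_1_iff of_int_mult)
  ultimately have "m = -1" "n = -1" by (auto simp: zmult_eq_1_iff)
  then have "2 * (\<alpha> i \<bullet> \<alpha> j) / (\<alpha> j \<bullet> \<alpha> j) = -1" "2 * (\<alpha> j \<bullet> \<alpha> i) / (\<alpha> i \<bullet> \<alpha> i) = -1"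
    using mn by (simp_all add: cartan_def)
  then show "root_reflection (\<alpha> j) (\<alpha> i) = \<alpha> i + \<alpha> j" "root_reflection (\<alpha> i) (\<alpha> j) = \<alpha> i + \<alpha> j"
    unfolding root_reflection_def by (simp_all add: add.commute)
qed

text \<open>A deformation \<open>Q\<close> assigns to each vertex \<open>w x\<close> a point \<open>q (w x)\<close>, and
  \<open>q (w x) - q (w s\<^sub>i x)\<close> is a nonnegative multiple of \<open>w \<alpha>\<^sub>i\<close>. Since all two-dimensional faces
  through an edge are triangles, the factor is the same for all \<open>w\<close>.\<close>

lemma unlabelled_indecomposable:
  assumes i: "i \<in> {1..d}" and "0 < k"
    and unlabelled: "\<And>j. j \<in> {1..d} \<Longrightarrow> j \<noteq> i \<Longrightarrow> \<alpha> i \<bullet> \<alpha> j \<noteq> 0 \<Longrightarrow> cartan i j * cartan j i = 1"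
  shows "indecomposable (convex hull (orbit \<Phi> (k *\<^sub>R \<omega> i)))"
proof -
  define x where "x = k *\<^sub>R \<omega> i"
  let ?P = "convex hull (orbit \<Phi> x)"
  let ?s = "root_reflection (\<alpha> i)"
  have domx: "base.dominant x" unfolding x_def using weight_dominant i \<open>0 < k\<close> by simp
  have fix_x: "root_reflection (\<alpha> l) x = x" if "l \<in> {1..d}" "l \<noteq> i" for l
    unfolding x_def using reflection_fixes_weight i that by blast
  have "2 * (x \<bullet> \<alpha> i) / (\<alpha> i \<bullet> \<alpha> i) = k"
    using i simple_nonzero by (simp add: x_def weight_inner_simple)
  then have s_x: "?s x = x - k *\<^sub>R \<alpha> i" by (simp add: root_reflection_def)
  have "\<exists>c\<ge>0. \<exists>t. Q = (\<lambda>z. t + c *\<^sub>R z) ` ?P" if Q: "deformation_of ?P Q" for Q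
  proof -
    have "\<exists>q\<in>Q. normal_cone ?P {v} \<subseteq> normal_cone Q {q}" if "v \<in> orbit \<Phi> x" for v
    proof -
      have "norm z = norm x" if "z \<in> orbit \<Phi> x" for z
        using that by (auto simp: orbit_def norm_reflect_word)
      then have "{v} face_of ?P" using that by (intro sphere_point_face) auto
      then show ?thesis using deformation_of_vertex[OF Q] by metis
    qed
    then obtain q where q: "\<And>v. v \<in> orbit \<Phi> x \<Longrightarrow> q v \<in> Q"
      "\<And>v. v \<in> orbit \<Phi> x \<Longrightarrow> normal_cone ?P {v} \<subseteq> normal_cone Q {q v}" by metis
    \<comment> \<open>A dominant \<open>u\<close> is maximal at \<open>x\<close>, so its image lies
      in the normal cone at the image of \<open>x\<close>, and this passes to
      \<open>Q\<close>.\<close>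
    have q_max: "reflect_word ws u \<bullet> y \<le> reflect_word ws u \<bullet> q (reflect_word ws x)"
      if "base.dominant u" "set ws \<subseteq> \<Phi>" "y \<in> Q" for u ws y
    proof -
      have "reflect_word ws u \<bullet> z \<le> reflect_word ws u \<bullet> reflect_word ws x" if "z \<in> orbit \<Phi> x" for z
        using base.dominant_max_reflect_word[OF \<open>base.dominant u\<close> domx \<open>set ws \<subseteq> \<Phi>\<close> hull_inc[OF that]]
        by (simp add: inner_reflect_word)
      then have "reflect_word ws u \<in> normal_cone ?P {reflect_word ws x}"
        unfolding normal_cone_convex_hull by blast
      then have "reflect_word ws u \<in> normal_cone Q {q (reflect_word ws x)}"
        using q(2) orbitI that by blast
      then show ?thesis using that by (simp add: normal_cone_def)
    qed
    \<comment> \<open>For \<open>j \<noteq> i\<close> the weight \<open>\<omega> j\<close> is fixed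
      by \<open>?s\<close>, so its image is maximal on \<open>Q\<close> at both
      \<open>q\<close>-values and their difference is orthogonal to it. Only the i-th coroot
      coordinate survives.\<close>
    have edge: "\<exists>\<kappa>\<ge>0. q (reflect_word ws x) - q (reflect_word ws (?s x)) = \<kappa> *\<^sub>R reflect_word ws (\<alpha> i)"
      if ws: "set ws \<subseteq> \<Phi>" for ws
    proof -
      let ?q1 = "q (reflect_word ws x)" and ?q2 = "q (reflect_word ws (?s x))"
      have ws': "set (ws @ [\<alpha> i]) \<subseteq> \<Phi>" using ws simple_in_\<Phi>[OF i] by simp
      have Q12: "?q1 \<in> Q" "?q2 \<in> Q"
        using q(1) orbitI[OF ws, of x] orbitI[OF ws', of x] by auto
      define r where "r = reflect_word (rev ws) (?q1 - ?q2)"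
      have r: "r \<bullet> u = reflect_word ws u \<bullet> ?q1 - reflect_word ws u \<bullet> ?q2" for u
        unfolding r_def inner_reflect_word_commute[of "rev ws"]
        by (simp add: inner_diff_left inner_commute[of "reflect_word ws u"])
      have dom: "base.dominant (\<omega> j)" if "j \<in> {1..d}" for j using weight_dominant[OF that, of 1] by simp
      have nonneg: "0 \<le> r \<bullet> \<omega> j" if "j \<in> {1..d}" for j
        unfolding r using q_max[OF dom[OF that] ws Q12(2)] by simp
      have "r \<bullet> \<omega> j = 0" if j: "j \<in> {1..d}" "j \<noteq> i" for j
      proof -
        have "?s (\<omega> j) = \<omega> j" using reflection_fixes_weight[OF j(1) i, of 1] j(2) by simp
        then have "r \<bullet> \<omega> j \<le> 0" unfolding r using q_max[OF dom[OF j(1)] ws' Q12(1)] by simp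
        then show ?thesis using nonneg[OF j(1)] by simp
      qed
      then have "(\<Sum>j\<in>{1..d}. (r \<bullet> \<omega> j) *\<^sub>R coroot (\<alpha> j)) = (r \<bullet> \<omega> i) *\<^sub>R coroot (\<alpha> i)"
        using i by (subst sum.remove[of _ i]) auto
      then have "r = (r \<bullet> \<omega> i * 2 / (\<alpha> i \<bullet> \<alpha> i)) *\<^sub>R \<alpha> i"
        using coroot_expansion[of r] by (simp add: coroot_def)
      then have "?q1 - ?q2 = (r \<bullet> \<omega> i * 2 / (\<alpha> i \<bullet> \<alpha> i)) *\<^sub>R reflect_word ws (\<alpha> i)"
        unfolding reflect_word_scaleR[symmetric] by (simp add: r_def)
      moreover have "0 \<le> r \<bullet> \<omega> i * 2 / (\<alpha> i \<bullet> \<alpha> i)" using nonneg[OF i] by simp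
      ultimately show ?thesis by blast
    qed
    obtain \<kappa> where "0 \<le> \<kappa>" and \<kappa>: "q x - q (?s x) = \<kappa> *\<^sub>R \<alpha> i" using edge[of "[]"] by auto
    have edge_\<kappa>: "q (reflect_word ws x) - q (reflect_word ws (?s x)) = \<kappa> *\<^sub>R reflect_word ws (\<alpha> i)"
      if "set ws \<subseteq> \<alpha> ` {1..d}" for ws
      using that
    proof (induction ws rule: rev_induct)
      case Nil
      then show ?case using \<kappa> by simp
    next
      case (snoc a ws)
      then obtain j where j: "j \<in> {1..d}" "a = \<alpha> j" by auto
      let ?sj = "root_reflection (\<alpha> j)"
      have IH: "q (reflect_word ws x) - q (reflect_word ws (?s x)) = \<kappa> *\<^sub>R reflect_word ws (\<alpha> i)"
        using snoc by simp
      have ws: "set ws \<subseteq> \<Phi>" using snoc simple_in_\<Phi> by auto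
      have commute: "?sj (?s x) = root_reflection (?sj (\<alpha> i)) (?sj x)" by (rule root_reflection_conj)
      \<comment> \<open>The new letter reverses the edge, keeps it (orthogonal roots), or moves it
        to another side of a triangle.\<close>
      consider "j = i" | "j \<noteq> i" "\<alpha> i \<bullet> \<alpha> j = 0" | "j \<noteq> i" "\<alpha> i \<bullet> \<alpha> j \<noteq> 0" by blast
      then show ?case
      proof cases
        case 1
        have "reflect_word ws (- \<alpha> i) = - reflect_word ws (\<alpha> i)"
          using reflect_word_scaleR[of ws "-1" "\<alpha> i"] by simp
        then show ?thesis
          using IH j 1 root_reflection_self[OF simple_nonzero[OF i]] by (simp add: algebra_simps)
      next
        case 2
        then have "?sj (\<alpha> i) = \<alpha> i" by (simp add: root_reflection_eq_self)
        then show ?thesis using IH j fix_x[OF j(1) 2(1)] commute by simp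
      next
        case 3
        note refl = unlabelled_cartan[OF i j(1) 3(1) unlabelled[OF j(1) 3]]
        obtain \<kappa>1 where \<kappa>1: "q (reflect_word ws x) - q (reflect_word ws (?sj (?s x)))
            = \<kappa>1 *\<^sub>R reflect_word ws (\<alpha> i + \<alpha> j)"
          using edge[of "ws @ [\<alpha> j]"] ws simple_in_\<Phi> j fix_x[OF j(1) 3(1)] refl by auto
        have ij: "?s (?sj (\<alpha> i)) = \<alpha> j"
          unfolding refl(1) using refl(2) by (metis add.commute root_reflection_invol)
        have "?sj (?s x) \<bullet> \<alpha> i = x \<bullet> ?s (?sj (\<alpha> i))" by (simp add: inner_root_reflection_commute)
        also have "\<dots> = 0" unfolding ij using i j 3 by (simp add: x_def weight_inner_simple)
        finally have "?s (?sj (?s x)) = ?sj (?s x)" by (rule root_reflection_eq_self)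
        then obtain \<kappa>2 where \<kappa>2: "q (reflect_word ws (?s x)) - q (reflect_word ws (?sj (?s x)))
            = \<kappa>2 *\<^sub>R reflect_word ws (\<alpha> j)"
          using edge[of "ws @ [\<alpha> i, \<alpha> j]"] ws simple_in_\<Phi> i j fix_x[OF j(1) 3(1)] ij by auto
        \<comment> \<open>The sides along \<open>\<alpha> i\<close>, \<open>\<alpha> j\<close> and
          their sum close up; pairing with \<open>\<omega> i\<close> compares the coefficients of
          \<open>\<alpha> i\<close>.\<close>
        have "\<kappa>1 *\<^sub>R reflect_word ws (\<alpha> i + \<alpha> j)
            = \<kappa> *\<^sub>R reflect_word ws (\<alpha> i) + \<kappa>2 *\<^sub>R reflect_word ws (\<alpha> j)"
          unfolding \<kappa>1[symmetric] \<kappa>2[symmetric] IH[symmetric] by simp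
        then have "reflect_word ws (\<kappa>1 *\<^sub>R (\<alpha> i + \<alpha> j)) = reflect_word ws (\<kappa> *\<^sub>R \<alpha> i + \<kappa>2 *\<^sub>R \<alpha> j)"
          by (simp only: reflect_word_scaleR reflect_word_add)
        then have "\<kappa>1 *\<^sub>R (\<alpha> i + \<alpha> j) = \<kappa> *\<^sub>R \<alpha> i + \<kappa>2 *\<^sub>R \<alpha> j"
          by (metis reflect_word_rev)
        then have "\<omega> i \<bullet> (\<kappa>1 *\<^sub>R (\<alpha> i + \<alpha> j)) = \<omega> i \<bullet> (\<kappa> *\<^sub>R \<alpha> i + \<kappa>2 *\<^sub>R \<alpha> j)" by simp
        then have "\<kappa>1 = \<kappa>"
          using i j 3 simple_nonzero[OF i] by (simp add: inner_add_right weight_inner_simple)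
        then show ?thesis using \<kappa>1 j fix_x[OF j(1) 3(1)] refl by simp
      qed
    qed
    \<comment> \<open>The corresponding edge of \<open>?P\<close> is
      \<open>k *\<^sub>R \<alpha> i\<close> by \<open>s_x\<close>.\<close>
    define c where "c = \<kappa> / k"
    define t where "t = q x - c *\<^sub>R x"
    have "0 \<le> c" using \<open>0 \<le> \<kappa>\<close> \<open>0 < k\<close> by (simp add: c_def)
    have "q (reflect_word ws x) = t + c *\<^sub>R reflect_word ws x" if "set ws \<subseteq> \<alpha> ` {1..d}" for ws
      using that
    proof (induction ws rule: rev_induct)
      case Nil
      then show ?case by (simp add: t_def)
    next
      case (snoc a ws)
      then obtain j where j: "j \<in> {1..d}" "a = \<alpha> j" by auto
      show ?case
      proof (cases "j = i")
        case True
        have "q (reflect_word ws (?s x)) = q (reflect_word ws x) - \<kappa> *\<^sub>R reflect_word ws (\<alpha> i)"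
          using edge_\<kappa>[of ws] snoc by (simp add: algebra_simps)
        also have "\<dots> = t + c *\<^sub>R reflect_word ws x - (c * k) *\<^sub>R reflect_word ws (\<alpha> i)"
          using snoc \<open>0 < k\<close> by (simp add: c_def)
        also have "\<dots> = t + c *\<^sub>R reflect_word ws (?s x)"
          by (simp add: s_x reflect_word_diff reflect_word_scaleR scaleR_diff_right)
        finally show ?thesis using j True by simp
      next
        case False
        then show ?thesis using snoc j fix_x by simp
      qed
    qed
    then have q_eq: "q v = t + c *\<^sub>R v" if "v \<in> orbit \<Phi> x" for v
      using that unfolding base.orbit_simple by (auto simp: orbit_def)
    \<comment> \<open>Every direction lies in the normal cone of some orbit point, so its maximum
      over \<open>Q\<close> is attained at a value of \<open>q\<close>; a separating hyperplane
      would contradict this.\<close>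
    have "Q = convex hull (q ` orbit \<Phi> x)"
    proof
      have "convex Q" using Q by (simp add: deformation_of_def polytope_imp_convex)
      then show "convex hull (q ` orbit \<Phi> x) \<subseteq> Q" using q(1) by (intro hull_minimal) auto
      show "Q \<subseteq> convex hull (q ` orbit \<Phi> x)"
      proof (rule ccontr)
        assume "\<not> ?thesis"
        then obtain y where y: "y \<in> Q" "y \<notin> convex hull (q ` orbit \<Phi> x)" by blast
        have "closed (convex hull (q ` orbit \<Phi> x))"
          by (intro compact_imp_closed finite_imp_compact_convex_hull finite_imageI finite_orbit_\<Phi>)
        then obtain u b where u: "u \<bullet> y < b" "\<And>z. z \<in> convex hull (q ` orbit \<Phi> x) \<Longrightarrow> b < u \<bullet> z"
          using separating_hyperplane_closed_point[OF convex_convex_hull _ y(2)] by metis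
        obtain u0 where u0: "u0 \<in> orbit \<Phi> (- u)" "base.dominant u0"
          using base.dominant_representative by metis
        then obtain ws where ws: "set ws \<subseteq> \<Phi>" "- u = reflect_word ws u0"
          using orbit_sym[OF u0(1)] by (auto simp: orbit_def)
        have "(- u) \<bullet> y \<le> (- u) \<bullet> q (reflect_word ws x)"
          using q_max[OF u0(2) ws(1) y(1)] by (simp add: ws(2))
        moreover have "b < u \<bullet> q (reflect_word ws x)"
          using ws(1) by (intro u(2) hull_inc imageI orbitI)
        ultimately show False using u(1) by simp
      qed
    qed
    also have "q ` orbit \<Phi> x = (\<lambda>v. t + c *\<^sub>R v) ` orbit \<Phi> x" using q_eq by (rule image_cong[OF refl])
    also have "convex hull \<dots> = (\<lambda>v. t + c *\<^sub>R v) ` ?P" by (rule convex_hull_affinity)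
    finally show ?thesis using \<open>0 \<le> c\<close> by blast
  qed
  moreover have "?P \<noteq> {p}" for p
  proof
    assume "?P = {p}"
    then have "x = p" "?s x = p"
      using hull_inc[OF orbit_refl[of x \<Phi>]] hull_inc[OF orbit_root_reflection[OF simple_in_\<Phi>[OF i] orbit_refl[of x \<Phi>]]]
      by auto
    then show False using s_x \<open>0 < k\<close> simple_nonzero[OF i] by simp
  qed
  moreover have "?P \<noteq> {}" using orbit_refl by auto
  ultimately show ?thesis
    using base.polytope_orbit[of x] unfolding indecomposable_def x_def by blast
qed

end

theorem theorem8p4:
  fixes \<Phi> :: "'a::euclidean_space set"
    and D :: "'a set"
    and d :: nat
    and \<alpha> \<omega> :: "nat \<Rightarrow> 'a"
    and x :: 'a
  assumes "root_system \<Phi>" and "crystallographic \<Phi>"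
    and "d = DIM('a)"
    and "chamber \<Phi> D"
    and "simple_root_enumeration \<Phi> D d \<alpha>"
    and "fundamental_weights d \<alpha> \<omega>"
  shows "(indecomposable (weight_polytope \<Phi> x) \<longleftrightarrow>
           (\<exists>k>0. \<exists>i\<in>{1..d}. incident_edges_unlabeled d \<alpha> i \<and>
              weight_polytope \<Phi> x = (\<lambda>v. k *\<^sub>R v) ` weight_polytope \<Phi> (\<omega> i))) \<and>
         (\<forall>i\<in>{1..d}. incident_edges_unlabeled d \<alpha> i \<longleftrightarrow>
              simply_laced_on d \<alpha> (insert i (dynkin_neighbors d \<alpha> i)))"
proof -
  interpret weyl_data \<Phi> D d \<alpha> \<omega> using assms by unfold_locales
  have scale: "convex hull (orbit \<Phi> (k *\<^sub>R \<omega> i)) = (\<lambda>v. k *\<^sub>R v) ` weight_polytope \<Phi> (\<omega> i)" for k i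
    by (simp add: orbit_scaleR weight_polytope_orbit convex_hull_scaling)
  have "\<exists>k>0. \<exists>i\<in>{1..d}. incident_edges_unlabeled d \<alpha> i \<and>
      weight_polytope \<Phi> x = (\<lambda>v. k *\<^sub>R v) ` weight_polytope \<Phi> (\<omega> i)"
    if indec: "indecomposable (weight_polytope \<Phi> x)"
  proof -
    obtain y where y: "y \<in> orbit \<Phi> x" "base.dominant y" using base.dominant_representative by metis
    have eq: "weight_polytope \<Phi> x = convex hull (orbit \<Phi> y)"
      using orbit_eq[OF y(1)] by (simp add: weight_polytope_orbit)
    then obtain i k where ik: "i \<in> {1..d}" "0 < k" "y = k *\<^sub>R \<omega> i"
      using indecomposable_dominant_multiple[OF y(2)] indec by metis
    then have "incident_edges_unlabeled d \<alpha> i"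
      unfolding incident_edges_unlabeled_iff[OF ik(1)]
      using labelled_edge_decomposable[OF ik(1) _ _ ik(2)] indec eq by metis
    then show ?thesis using ik eq scale by metis
  qed
  moreover have "indecomposable (weight_polytope \<Phi> x)"
    if "0 < k" "i \<in> {1..d}" "incident_edges_unlabeled d \<alpha> i"
      "weight_polytope \<Phi> x = (\<lambda>v. k *\<^sub>R v) ` weight_polytope \<Phi> (\<omega> i)" for k i
    using unlabelled_indecomposable[OF that(2,1)] that(3)
    unfolding incident_edges_unlabeled_iff[OF that(2)] that(4) scale by blast
  ultimately show ?thesis using simply_laced_neighborhood by blast
qed

end
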